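(* Let $(M^3,T,\bar d)$ be a closed three-dimensional piecewise flat metrized manifold and let $f(t)$ be a conformal variation of it, with extension $\mathcal{C}:U\to\mathfrak{met}(M,T)$. Write $d(t)=\mathcal{C}[f(t)]$, and let $\ell(f(t))$ be the lengths induced by $d(t)$. Then at $t=0$ $$\frac{d}{dt}\mathcal{EHR}(M,T,\ell(f(t)))=\sum_{i\in V(T)}K_i\frac{df_i}{dt},$$ $$\frac{d^2}{dt^2}\mathcal{EHR}(M,T,\ell(f(t)))=\sum_i\sum_{j\ne i}\left(\frac{\ell_{ij}^*}{\ell_{ij}}-\frac{q_{ij}}{2\ell_{ij}}K_{ij}\right)\left(\frac{df_j}{dt}-\frac{df_i}{dt}\right)^2+\sum_iK_i\left[\left(\frac{df_i}{dt}\right)^2+\frac{d^2f_i}{dt^2}\right],$$ where $q_{ij}=\dfrac{\partial d_{ij}}{\partial f_j}=\dfrac{\partial d_{ji}}{\partial f_i}$, and the double sums are over vertices $i$ and, for each $i$, all $j$ such that $\{i,j\}\in E(T)$. Thus $\bar d$ is a critical point of $\mathcal{EHR}$ under conformal variations (i.e. $f(0)$ is a critical point of $f\mapsto\mathcal{EHR}(M,T,\ell(f))$ on $U$) if and only if $K_i=0$ for all $i\in V(T)$, and at such a critical metric $$\frac{d^2}{dt^2}\mathcal{EHR}(M,T,\ell(f(t)))=\sum_i\sum_{j\ne i}\left(\frac{\ell_{ij}^*}{\ell_{ij}}-\frac{q_{ij}}{2\ell_{ij}}K_{ij}\right)\left(\frac{df_j}{dt}-\frac{df_i}{dt}\right)^2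 .$$ Furthermore, if the lengths $\ell$ of $\bar d$ are a critical point of $\mathcal{EHR}(M,T,\ell)$ as a function of all the edge lengths $\ell$, then $K_{ij}=0$ for every edge, and hence $$\frac{d^2}{dt^2}\mathcal{EHR}(M,T,\ell(f(t)))=\sum_i\sum_{j\ne i}\frac{\ell_{ij}^*}{\ell_{ij}}\left(\frac{df_j}{dt}-\frac{df_i}{dt}\right)^2 .$$
   Context: A triangulated manifold $(M,T)$ is a topological manifold with a triangulation $T$ (here finite, and simplices are determined by their vertices and written $\{i,j,\dots,k\}$). $V(T)$, $E(T)$, $E_+(T)$ are the sets of vertices, edges, and directed edges (each edge $\{i,j\}$ gives two directed edges $(i,j)$ and $(j,i)$); $X^*$ is the vector space of functions $X\to\mathbb{R}$. $(M,T,\ell)$, with $\ell\in E(T)^*$, is piecewise flat if every simplex can be realized as a nondegenerate Euclidean simplex with edge lengths given by $\ell$. A (piecewise flat) metric is $d\in E_+(T)^*$ such that with $\ell_{ij}=d_{ij}+d_{ji}$, $(M,T,\ell)$ is piecewise flat, and for every triangle $\{i,j,k\}$: $d_{ij}^2+d_{jk}^2+d_{ki}^2=d_{ji}^2+d_{ik}^2+d_{kj}^2$. (The $d_{ij}$ may be negative.) Then $(M,T,d)$ is a piecewise flat metrized manifold; $\mathfrak{met}(M,T)$ is the set of all metrics $d$. A conformal structure on an open set $U\subset V(T)^*$ is a smooth map $\mathcal{C}:U\to\mathfrak{met}(M,T)\subset E_+(T)^*$ such that, writing $d=\mathcal{C}[f]$ and $\ell_{ij}=d_{ij}+d_{ji}$,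 for each $(i,j)\in E_+(T)$ and $k\in V(T)$: $\partial\ell_{ij}/\partial f_i=d_{ij}$, and $\partial d_{ij}/\partial f_k=0$ if $k\ne i$ and $k\neq j$. A conformal variation of $(M,T,\bar d)$ is a smooth curve $f:(-\varepsilon,\varepsilon)\to V(T)^*$ for which there is a conformal structure $\mathcal{C}:U\to\mathfrak{met}(M,T)$ with $f((-\varepsilon,\varepsilon))\subset U$ and $\mathcal{C}[f(0)]=\bar d$; such $\mathcal{C}$ is called an extension of the variation. All quantities for a conformal variation are evaluated at $t=0$. $\gamma_{i,jk}$ is the angle at vertex $i$ in triangle $\{i,j,k\}$; $\beta_{ij,k\ell}$ is the dihedral angle at edge $\{i,j\}$ in tetrahedron $\{i,j,k,\ell\}$. Define $$h_{ij,k}=\frac{d_{ik}-d_{ij}\cos\gamma_{i,jk}}{\sin\gamma_{i,jk}},\qquad h_{ijk,\ell}=\frac{h_{ij,\ell}-h_{ij,k}\cos\beta_{ij,k\ell}}{\sin\beta_{ij,k\ell}},\qquad A_{ij,k\ell}=\tfrac12\left(h_{ij,k}h_{ijk,\ell}+h_{ij,\ell}h_{ij\ell,k}\right)$$ (signed distance from the triangle's center to an edge; signed distance from the tetrahedron's center to a face; signed dual area). The dual length is $\ell_{ij}^*=\sum A_{ij,k\ell}$, the sum over all tetrahedra $\{i,j,k,\ell\}$ containing $\{i,j\}$, each counted once. The edge curvature is $K_{ij}=\left(2\pi-\sum\beta_{ij,k\ell}\right)\ell_{ij}$ and the scalar curvature at vertex $i$ is $K_i=\sum_{j}\left(2\pi-\sum\beta_{ij,k\ell}\right)d_{ij}$,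 where the outer sum is over edges $\{i,j\}$ containing $i$ and the inner sums are over all tetrahedra $\{i,j,k,\ell\}$ containing $\{i,j\}$. The Einstein-Hilbert-Regge functional is $\mathcal{EHR}(M,T,\ell)=\sum_{\{i,j\}\in E(T)}K_{ij}$. *)

theory Defs
  imports "HOL-Analysis.Analysis"
begin

subsection \<open>Spaces of functions, smoothness, critical points\<close>

text \<open>The space \<open>X\<^sup>*\<close> of functions on a subset \<open>X\<close> of a finite index type is the linear
  subspace of vectors vanishing off \<open>X\<close>. It has the right dimension, unlike the whole of
  \<open>real ^ 'a\<close>.\<close>

definition functions_on :: "'a::finite set \<Rightarrow> (real ^ 'a) set" where
  "functions_on X = {x. \<forall>a. a \<notin> X \<longrightarrow> x $ a = 0}"

text \<open>Meant for open \<open>S\<close> and a finite-dimensional domain, where it is the usual \<open>C\<^sup>n\<close>.\<close>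

primrec Ck_on :: "nat \<Rightarrow> 'a set \<Rightarrow> ('a::real_normed_vector \<Rightarrow> 'b::real_normed_vector) \<Rightarrow> bool" where
  "Ck_on 0 S F \<longleftrightarrow> continuous_on S F"
| "Ck_on (Suc n) S F \<longleftrightarrow> (\<forall>x\<in>S. F differentiable (at x)) \<and>
     (\<forall>v. Ck_on n S (\<lambda>x. frechet_derivative F (at x) v))"

definition smooth_on :: "'a set \<Rightarrow> ('a::real_normed_vector \<Rightarrow> 'b::real_normed_vector) \<Rightarrow> bool" where
  "smooth_on S F \<longleftrightarrow> (\<forall>n. Ck_on n S F)"

definition partial :: "'a::finite \<Rightarrow> (real ^ 'a \<Rightarrow> real) \<Rightarrow> real ^ 'a \<Rightarrow> real" where
  "partial k F x = deriv (\<lambda>s. F (x + s *\<^sub>R axis k 1)) 0"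

definition has_second_real_derivative :: "(real \<Rightarrow> real) \<Rightarrow> real \<Rightarrow> real \<Rightarrow> bool" where
  "has_second_real_derivative F D x \<longleftrightarrow>
     (\<exists>F'. (\<forall>\<^sub>F y in nhds x. (F has_real_derivative F' y) (at y)) \<and>
           (F' has_real_derivative D) (at x))"

definition critical_point_on :: "('a::real_normed_vector \<Rightarrow> real) \<Rightarrow> 'a set \<Rightarrow> 'a \<Rightarrow> bool" where
  "critical_point_on F S x \<longleftrightarrow> x \<in> S \<and> (F has_derivative (\<lambda>_. 0)) (at x within S)"


subsection \<open>Triangulated manifolds\<close>

definition second_countable_space :: "'a topology \<Rightarrow> bool" where
  "second_countable_space X \<longleftrightarrow>
     (\<exists>\<B>. countable \<B> \<and> (\<forall>W\<in>\<B>. openin X W) \<and>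
       (\<forall>U x. openin X U \<and> x \<in> U \<longrightarrow> (\<exists>W\<in>\<B>. x \<in> W \<and> W \<subseteq> U)))"

definition topological_manifold :: "nat \<Rightarrow> 'a topology \<Rightarrow> bool" where
  "topological_manifold n X \<longleftrightarrow>
     Hausdorff_space X \<and> second_countable_space X \<and>
     (\<forall>x\<in>topspace X. \<exists>U V. openin X U \<and> x \<in> U \<and> openin (Euclidean_space n) V \<and>
        subtopology X U homeomorphic_space subtopology (Euclidean_space n) V)"

text \<open>Finite abstract simplicial complexes, given by their nonempty simplices, whose vertex set
  is the whole of the finite type \<open>'v\<close>.\<close>

definition simplicial_complex_on_UNIV :: "'v::finite set set \<Rightarrow> bool" where
  "simplicial_complex_on_UNIV T \<longleftrightarrow>
     {} \<notin> T \<and> (\<forall>v. {v} \<in> T) \<and> (\<forall>\<sigma>\<in>T. \<forall>\<tau>. \<tau> \<noteq> {} \<and> \<tau> \<subseteq> \<sigma> \<longrightarrow> \<tau> \<in> T)"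

definition geometric_realization :: "'v::finite set set \<Rightarrow> (real ^ 'v) set" where
  "geometric_realization T = (\<Union>\<sigma>\<in>T. convex hull ((\<lambda>v. axis v 1) ` \<sigma>))"

definition closed_triangulated_manifold :: "nat \<Rightarrow> 'm topology \<Rightarrow> 'v::finite set set \<Rightarrow> bool" where
  "closed_triangulated_manifold n M T \<longleftrightarrow>
     topological_manifold n M \<and> compact_space M \<and> simplicial_complex_on_UNIV T \<and>
     top_of_set (geometric_realization T) homeomorphic_space M"

definition edges :: "'v set set \<Rightarrow> 'v set set" where
  "edges T = {e \<in> T. card e = 2}"

definition directed_edges :: "'v set set \<Rightarrow> ('v \<times> 'v) set" where
  "directed_edges T = {(i, j). i \<noteq> j \<and> {i, j} \<in> T}"

text \<open>For symmetric \<open>F\<close>, the sum of \<open>F k l\<close> over all tetrahedra \<open>{i, j, k, l}\<close> containing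
  \<open>{i, j}\<close>: both orderings of the two remaining vertices occur in the sum below, hence the
  factor \<open>1 / 2\<close>.\<close>

definition tetrahedra_sum :: "'v::finite set set \<Rightarrow> 'v \<Rightarrow> 'v \<Rightarrow> ('v \<Rightarrow> 'v \<Rightarrow> real) \<Rightarrow> real" where
  "tetrahedra_sum T i j F =
     (\<Sum>(k, l) \<in> {(k, l). {i, j, k, l} \<in> T \<and> card {i, j, k, l} = 4}. F k l) / 2"


subsection \<open>Euclidean realizations and angles\<close>

text \<open>Nondegenerate Euclidean simplices on the vertex set \<open>\<sigma>\<close> with given edge lengths.
  The ambient space \<open>real ^ 'v\<close> is large enough for every simplex.\<close>

definition realizes :: "('v::finite \<Rightarrow> real ^ 'v) \<Rightarrow> 'v set \<Rightarrow> real ^ ('v set) \<Rightarrow> bool" where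
  "realizes p \<sigma> len \<longleftrightarrow> inj_on p \<sigma> \<and> \<not> affine_dependent (p ` \<sigma>) \<and>
     (\<forall>i\<in>\<sigma>. \<forall>j\<in>\<sigma>. i \<noteq> j \<longrightarrow> dist (p i) (p j) = len $ {i, j})"

definition piecewise_flat :: "'v::finite set set \<Rightarrow> real ^ ('v set) \<Rightarrow> bool" where
  "piecewise_flat T len \<longleftrightarrow> len \<in> functions_on (edges T) \<and> (\<forall>\<sigma>\<in>T. \<exists>p. realizes p \<sigma> len)"

definition vangle :: "'a::real_inner \<Rightarrow> 'a \<Rightarrow> real" where
  "vangle x y = arccos (x \<bullet> y / (norm x * norm y))"

definition perp :: "'a::real_inner \<Rightarrow> 'a \<Rightarrow> 'a" where
  "perp e x = x - ((x \<bullet> e) / (e \<bullet> e)) *\<^sub>R e"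

text \<open>The angles below do not depend on the realization chosen; see the lemmas
  \<open>angle_at_realization\<close> and \<open>dihedral_angle_realization\<close>.\<close>

definition angle_at :: "real ^ ('v::finite set) \<Rightarrow> 'v \<Rightarrow> 'v \<Rightarrow> 'v \<Rightarrow> real" where
  "angle_at len i j k =
     (let p = (SOME p. realizes p {i, j, k} len) in vangle (p j - p i) (p k - p i))"

definition dihedral_angle :: "real ^ ('v::finite set) \<Rightarrow> 'v \<Rightarrow> 'v \<Rightarrow> 'v \<Rightarrow> 'v \<Rightarrow> real" where
  "dihedral_angle len i j k l =
     (let p = (SOME p. realizes p {i, j, k, l} len)
      in vangle (perp (p j - p i) (p k - p i)) (perp (p j - p i) (p l - p i)))"


subsection \<open>Metrics and conformal variations\<close>

text \<open>Each edge \<open>{i, j}\<close> receives \<open>d $ (i, j) + d $ (j, i)\<close>; see the lemma \<open>lengths_edge\<close>.\<close>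

definition lengths :: "'v::finite set set \<Rightarrow> real ^ ('v \<times> 'v) \<Rightarrow> real ^ ('v set)" where
  "lengths T d = (\<chi> e. \<Sum>(i, j) \<in> {(i, j). (i, j) \<in> directed_edges T \<and> {i, j} = e}. d $ (i, j))"

definition metrics :: "'v::finite set set \<Rightarrow> (real ^ ('v \<times> 'v)) set" where
  "metrics T = {d \<in> functions_on (directed_edges T). piecewise_flat T (lengths T d) \<and>
     (\<forall>i j k. {i, j, k} \<in> T \<and> card {i, j, k} = 3 \<longrightarrow>
        (d $ (i, j))\<^sup>2 + (d $ (j, k))\<^sup>2 + (d $ (k, i))\<^sup>2 =
        (d $ (j, i))\<^sup>2 + (d $ (i, k))\<^sup>2 + (d $ (k, j))\<^sup>2)}"

definition conformal_structure ::
  "'v::finite set set \<Rightarrow> (real ^ 'v) set \<Rightarrow> (real ^ 'v \<Rightarrow> real ^ ('v \<times> 'v)) \<Rightarrow> bool" where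
  "conformal_structure T U C \<longleftrightarrow>
     open U \<and> smooth_on U C \<and> C ` U \<subseteq> metrics T \<and>
     (\<forall>f\<in>U. \<forall>(i, j)\<in>directed_edges T.
        partial i (\<lambda>g. lengths T (C g) $ {i, j}) f = C f $ (i, j) \<and>
        (\<forall>k. k \<noteq> i \<and> k \<noteq> j \<longrightarrow> partial k (\<lambda>g. C g $ (i, j)) f = 0))"

definition conformal_extension ::
  "'v::finite set set \<Rightarrow> real ^ ('v \<times> 'v) \<Rightarrow> real \<Rightarrow> (real \<Rightarrow> real ^ 'v) \<Rightarrow>
   (real ^ 'v) set \<Rightarrow> (real ^ 'v \<Rightarrow> real ^ ('v \<times> 'v)) \<Rightarrow> bool" where
  "conformal_extension T dbar \<epsilon> f U C \<longleftrightarrow>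
     conformal_structure T U C \<and> f ` {-\<epsilon><..<\<epsilon>} \<subseteq> U \<and> C (f 0) = dbar"

definition conformal_variation ::
  "'v::finite set set \<Rightarrow> real ^ ('v \<times> 'v) \<Rightarrow> real \<Rightarrow> (real \<Rightarrow> real ^ 'v) \<Rightarrow> bool" where
  "conformal_variation T dbar \<epsilon> f \<longleftrightarrow>
     0 < \<epsilon> \<and> smooth_on {-\<epsilon><..<\<epsilon>} f \<and> (\<exists>U C. conformal_extension T dbar \<epsilon> f U C)"


subsection \<open>Centers, dual lengths and curvatures\<close>

definition height2 :: "'v::finite set set \<Rightarrow> real ^ ('v \<times> 'v) \<Rightarrow> 'v \<Rightarrow> 'v \<Rightarrow> 'v \<Rightarrow> real" where
  "height2 T d i j k =
     (let \<gamma> = angle_at (lengths T d) i j k in (d $ (i, k) - d $ (i, j) * cos \<gamma>) / sin \<gamma>)"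

definition height3 :: "'v::finite set set \<Rightarrow> real ^ ('v \<times> 'v) \<Rightarrow> 'v \<Rightarrow> 'v \<Rightarrow> 'v \<Rightarrow> 'v \<Rightarrow> real" where
  "height3 T d i j k l =
     (let \<beta> = dihedral_angle (lengths T d) i j k l
      in (height2 T d i j l - height2 T d i j k * cos \<beta>) / sin \<beta>)"

definition dual_area :: "'v::finite set set \<Rightarrow> real ^ ('v \<times> 'v) \<Rightarrow> 'v \<Rightarrow> 'v \<Rightarrow> 'v \<Rightarrow> 'v \<Rightarrow> real" where
  "dual_area T d i j k l =
     (height2 T d i j k * height3 T d i j k l + height2 T d i j l * height3 T d i j l k) / 2"

definition dual_length :: "'v::finite set set \<Rightarrow> real ^ ('v \<times> 'v) \<Rightarrow> 'v \<Rightarrow> 'v \<Rightarrow> real" where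
  "dual_length T d i j = tetrahedra_sum T i j (dual_area T d i j)"

definition angle_deficit :: "'v::finite set set \<Rightarrow> real ^ ('v set) \<Rightarrow> 'v \<Rightarrow> 'v \<Rightarrow> real" where
  "angle_deficit T len i j = 2 * pi - tetrahedra_sum T i j (dihedral_angle len i j)"

definition edge_curvature :: "'v::finite set set \<Rightarrow> real ^ ('v set) \<Rightarrow> 'v \<Rightarrow> 'v \<Rightarrow> real" where
  "edge_curvature T len i j = angle_deficit T len i j * len $ {i, j}"

definition scalar_curvature :: "'v::finite set set \<Rightarrow> real ^ ('v \<times> 'v) \<Rightarrow> 'v \<Rightarrow> real" where
  "scalar_curvature T d i =
     (\<Sum>j | (i, j) \<in> directed_edges T. angle_deficit T (lengths T d) i j * d $ (i, j))"

text \<open>The sum over edges is half the sum over directed edges; the edge curvature is symmetric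
  by the lemma \<open>edge_curvature_commute\<close>.\<close>

definition EHR :: "'v::finite set set \<Rightarrow> real ^ ('v set) \<Rightarrow> real" where
  "EHR T len = (\<Sum>(i, j)\<in>directed_edges T. edge_curvature T len i j) / 2"


subsection \<open>Well-definedness\<close>

lemma lengths_edge:
  assumes "(i, j) \<in> directed_edges T"
  shows "lengths T d $ {i, j} = d $ (i, j) + d $ (j, i)"
proof -
  have "{(a, b). (a, b) \<in> directed_edges T \<and> {a, b} = {i, j}} = {(i, j), (j, i)}"
    using assms by (auto simp: directed_edges_def doubleton_eq_iff insert_commute)
  moreover have "i \<noteq> j" using assms by (auto simp: directed_edges_def)
  ultimately show ?thesis by (simp add: lengths_def)
qed

lemma inner_diff_dist:
  fixes a b c :: "'a::real_inner"
  shows "(b - a) \<bullet> (c - a) = ((dist a b)\<^sup>2 + (dist a c)\<^sup>2 - (dist b c)\<^sup>2) / 2"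
  by (simp add: dist_norm power2_norm_eq_inner inner_diff_left inner_diff_right inner_commute)

lemma realizes_inner_eq:
  assumes "realizes p \<sigma> len" "realizes q \<sigma> len" "i \<in> \<sigma>" "j \<in> \<sigma>" "k \<in> \<sigma>"
  shows "(p j - p i) \<bullet> (p k - p i) = (q j - q i) \<bullet> (q k - q i)"
proof -
  have "dist (p a) (p b) = dist (q a) (q b)" if "a \<in> \<sigma>" "b \<in> \<sigma>" for a b
    using assms(1,2) that unfolding realizes_def by (cases "a = b") auto
  then show ?thesis using assms(3-5) by (simp add: inner_diff_dist)
qed

lemma vangle_cong:
  assumes "x \<bullet> y = x' \<bullet> y'" "x \<bullet> x = x' \<bullet> x'" "y \<bullet> y = y' \<bullet> y'"
  shows "vangle x y = vangle x' y'"
  using assms by (simp add: vangle_def norm_eq_sqrt_inner)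

lemma inner_perp:
  "perp e x \<bullet> perp e y = x \<bullet> y - (x \<bullet> e) * (y \<bullet> e) / (e \<bullet> e)"
  by (cases "e = 0")
    (simp_all add: perp_def inner_diff_left inner_diff_right inner_commute)

lemma angle_at_realization:
  assumes "realizes p {i, j, k} len"
  shows "angle_at len i j k = vangle (p j - p i) (p k - p i)"
proof -
  define q where "q = (SOME p. realizes p {i, j, k} len)"
  have q: "realizes q {i, j, k} len"
    unfolding q_def using assms by (rule someI[where P = "\<lambda>p. realizes p {i, j, k} len"])
  note eq = realizes_inner_eq[OF q assms, of i]
  show ?thesis unfolding angle_at_def Let_def q_def[symmetric]
    by (rule vangle_cong) (auto intro!: eq)
qed

lemma dihedral_angle_realization:
  assumes "realizes p {i, j, k, l} len"
  shows "dihedral_angle len i j k l =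
    vangle (perp (p j - p i) (p k - p i)) (perp (p j - p i) (p l - p i))"
proof -
  define q where "q = (SOME p. realizes p {i, j, k, l} len)"
  have q: "realizes q {i, j, k, l} len"
    unfolding q_def using assms by (rule someI[where P = "\<lambda>p. realizes p {i, j, k, l} len"])
  note eq = realizes_inner_eq[OF q assms, of i]
  show ?thesis unfolding dihedral_angle_def Let_def q_def[symmetric]
    by (rule vangle_cong) (simp_all add: inner_perp eq)
qed

lemma dihedral_angle_commute:
  "dihedral_angle len j i k l = dihedral_angle len i j k l"
  "dihedral_angle len i j l k = dihedral_angle len i j k l"
proof -
  have swap: "perp (- e) (y - e) = perp e y" for e y :: "real ^ 'a"
    by (cases "e = 0") (simp_all add: perp_def inner_diff_left diff_divide_distrib algebra_simps)
  have perp_swap: "perp (a - b) (x - b) = perp (b - a) (x - a)" for a b x :: "real ^ 'a"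
    using swap[of "b - a" "x - a"] by (simp add: algebra_simps)
  have "{j, i, k, l} = {i, j, k, l}" by auto
  then show "dihedral_angle len j i k l = dihedral_angle len i j k l"
    unfolding dihedral_angle_def Let_def by (simp add: perp_swap)
  have "{i, j, l, k} = {i, j, k, l}" by auto
  then show "dihedral_angle len i j l k = dihedral_angle len i j k l"
    unfolding dihedral_angle_def Let_def vangle_def by (simp add: inner_commute mult.commute)
qed

lemma edge_curvature_commute: "edge_curvature T len j i = edge_curvature T len i j"
  by (simp add: edge_curvature_def angle_deficit_def tetrahedra_sum_def insert_commute
      dihedral_angle_commute(1)[of len j i])

end

theory Submission
  imports Defs
begin

text \<open>Everything is local to a tetrahedron. Fix a realization \<open>p\<close> of it and let its vertices move with
velocities \<open>V\<close>. Each face turns about each of its edges \<open>{i, j}\<close> at some rate towards the opposite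
vertex, and the dihedral angle at \<open>{i, j}\<close> shrinks at the sum of the rates of the two faces that
meet there (\<open>dihedral_angle_has_derivative\<close>). The rate of a face at an edge is the inward normal
derivative, across that edge, of the affine function on the face that interpolates the normal
velocities of the three vertices. Two identities of plane geometry follow.

\<^item> The inward normals of a triangle, weighted by edge length, add up to zero; so the rates of a
  face, weighted by edge length, add up to zero (\<open>face_rotation_schlaefli\<close>). Summed over all faces
  this is the Schlaefli formula, and the derivative of \<open>EHR\<close> is the sum of angle deficit times
  variation of length (\<open>EHR_has_derivative\<close>).

\<^item> The compatibility condition on triangles gives every tetrahedron a center \<open>c\<close>, from which
  \<open>d\<^sub>i\<^sub>j\<close> is read off by projecting \<open>c\<close> to the edges (\<open>is_center_exists\<close>). The conformal variation
  with parameter \<open>\<phi>\<close> has \<open>\<ell>'\<^sub>i\<^sub>j = d\<^sub>i\<^sub>j \<phi>\<^sub>i + d\<^sub>j\<^sub>i \<phi>\<^sub>j\<close> and is induced by the motion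
  \<open>V\<^sub>m = \<phi>\<^sub>m (p\<^sub>m - c)\<close>. The normal velocities on a face are then \<open>\<phi>\<close> times minus the signed distance
  of \<open>c\<close> from the face, and the rates of the face, weighted by \<open>\<ell>'\<close>, add up to
  the sum over its edges of \<open>h\<^sub>i\<^sub>j\<^sub>,\<^sub>k h\<^sub>i\<^sub>j\<^sub>k\<^sub>,\<^sub>l (\<phi>\<^sub>i - \<phi>\<^sub>j)\<^sup>2 / \<ell>\<^sub>i\<^sub>j\<close> (\<open>conformal_face_sum\<close>).
  Summed over all faces this is the term with the dual lengths.

The first identity gives the first derivative \<open>\<Sum>\<^sub>i K\<^sub>i \<phi>\<^sub>i\<close>. Differentiating it again varies the
deficits, which the second identity handles, and the \<open>d\<^sub>i\<^sub>j\<close>, whose derivatives are determined by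
\<open>d\<close> and \<open>q\<close> because mixed partial derivatives of the lengths agree (\<open>conformal_metric_derivative\<close>).

For the last claim every single edge length has to be variable on its own. Realizability is
positive definiteness of a Gram matrix in the squared lengths, hence stable under small changes
(\<open>eventually_piecewise_flat\<close>); so a critical point in all lengths has zero deficit at each edge.\<close>


section \<open>Edge vectors of a realized simplex\<close>

text \<open>The restriction of a linear functional to the span of \<open>B\<close> is represented by a vector of that
  span.\<close>

lemma independent_prescribed_inner:
  fixes B :: "'a::euclidean_space set"
  assumes "independent B"
  obtains w where "w \<in> span B" "\<And>b. b \<in> B \<Longrightarrow> w \<bullet> b = g b"
proof -
  obtain \<phi> :: "'a \<Rightarrow> real" where \<phi>: "linear \<phi>" "\<forall>b\<in>B. \<phi> b = g b"
    using linear_independent_extend[OF assms, of g] by blast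
  obtain w z where w: "w \<in> span B" "\<And>v. v \<in> span B \<Longrightarrow> orthogonal z v" "adjoint \<phi> 1 = w + z"
    using orthogonal_subspace_decomp_exists[of B "adjoint \<phi> 1"] by metis
  have "w \<bullet> b = g b" if b: "b \<in> B" for b
  proof -
    have "z \<bullet> b = 0" using w(2)[OF span_base[OF b]] by (simp add: orthogonal_def)
    then have "w \<bullet> b = b \<bullet> adjoint \<phi> 1" by (simp add: w(3) inner_add_left inner_commute[of b])
    then show ?thesis using adjoint_works[OF \<phi>(1), of b 1] \<phi>(2) b by simp
  qed
  with w(1) show ?thesis using that by blast
qed

lemma realizes_edge_vectors:
  assumes "realizes p \<sigma> len" "i \<in> \<sigma>"
  shows "inj_on (\<lambda>a. p a - p i) (\<sigma> - {i})" "independent ((\<lambda>a. p a - p i) ` (\<sigma> - {i}))"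
proof -
  have inj: "inj_on p \<sigma>" and ind: "\<not> affine_dependent (p ` \<sigma>)"
    using assms(1) by (auto simp: realizes_def)
  show "inj_on (\<lambda>a. p a - p i) (\<sigma> - {i})" using inj by (auto simp: inj_on_def)
  have "p ` \<sigma> - {p i} = p ` (\<sigma> - {i})"
    using inj assms(2) by (auto simp: inj_on_def)
  then have "(\<lambda>x. - p i + x) ` (p ` \<sigma> - {p i}) = (\<lambda>a. p a - p i) ` (\<sigma> - {i})"
    by (simp add: image_image)
  then show "independent ((\<lambda>a. p a - p i) ` (\<sigma> - {i}))"
    using ind affine_dependent_iff_dependent2[of "p i" "p ` \<sigma>"] assms(2) by auto
qed

text \<open>Independence of the edge vectors at \<open>i\<close>, indexed by vertices rather than by vectors.\<close>

lemma realizes_combination_eq_0: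
  assumes "realizes p \<sigma> len" "i \<in> \<sigma>" "(\<Sum>a\<in>\<sigma> - {i}. x a *\<^sub>R (p a - p i)) = 0" "a \<in> \<sigma> - {i}"
  shows "x a = 0"
proof -
  note inj = realizes_edge_vectors(1)[OF assms(1,2)]
  note ind = realizes_edge_vectors(2)[OF assms(1,2)]
  define e where "e = (\<lambda>a. p a - p i)"
  note inv = the_inv_into_f_f[OF inj[folded e_def]]
  have "(\<Sum>v\<in>e ` (\<sigma> - {i}). x (the_inv_into (\<sigma> - {i}) e v) *\<^sub>R v) = (\<Sum>a\<in>\<sigma> - {i}. x a *\<^sub>R e a)"
    unfolding sum.reindex[OF inj[folded e_def]] o_def by (intro sum.cong refl) (simp add: inv)
  also have "\<dots> = 0" using assms(3) by (simp add: e_def)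
  finally have "x (the_inv_into (\<sigma> - {i}) e (e a)) = 0"
    using assms(4)
    by (intro independentD[OF ind[folded e_def] finite_imageI subset_refl,
          where u = "\<lambda>v. x (the_inv_into (\<sigma> - {i}) e v)"]) auto
  then show ?thesis using assms(4) by (simp add: inv)
qed

lemma realizes_prescribed_inner:
  assumes "realizes p \<sigma> len" "i \<in> \<sigma>"
  obtains w where "\<And>a. a \<in> \<sigma> - {i} \<Longrightarrow> w \<bullet> (p a - p i) = g a"
proof -
  define e where "e = (\<lambda>a. p a - p i)"
  obtain w where w: "\<And>b. b \<in> e ` (\<sigma> - {i}) \<Longrightarrow> w \<bullet> b = g (the_inv_into (\<sigma> - {i}) e b)"
    using independent_prescribed_inner[OF realizes_edge_vectors(2)[OF assms],
        of "\<lambda>b. g (the_inv_into (\<sigma> - {i}) e b)"] unfolding e_def by blast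
  have "w \<bullet> e a = g a" if "a \<in> \<sigma> - {i}" for a
    using w[OF imageI[OF that]] the_inv_into_f_f[OF realizes_edge_vectors(1)[OF assms] that]
    by (simp add: e_def)
  then show ?thesis using that unfolding e_def by blast
qed

lemma realizes_subset:
  assumes "realizes p \<sigma> len" "\<tau> \<subseteq> \<sigma>"
  shows "realizes p \<tau> len"
  using assms affine_dependent_subset[of "p ` \<tau>" "p ` \<sigma>"]
  unfolding realizes_def by (auto intro: inj_on_subset image_mono)

lemma realizes_dist:
  assumes "realizes p \<sigma> len" "a \<in> \<sigma>" "b \<in> \<sigma>" "a \<noteq> b"
  shows "norm (p a - p b) = len $ {a, b}" "0 < len $ {a, b}"
    "(p a - p b) \<bullet> (p a - p b) = (len $ {a, b})\<^sup>2"
proof -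
  show *: "norm (p a - p b) = len $ {a, b}"
    using assms by (auto simp: realizes_def dist_norm)
  have "p a \<noteq> p b" using assms by (auto simp: realizes_def inj_on_def)
  then show "0 < len $ {a, b}" by (simp flip: *)
  show "(p a - p b) \<bullet> (p a - p b) = (len $ {a, b})\<^sup>2"
    by (simp flip: * add: power2_norm_eq_inner)
qed

lemma tetrahedron_combination_eq_0:
  assumes "realizes p {i, j, k, l} len" "card {i, j, k, l} = 4"
    "\<alpha> *\<^sub>R (p j - p i) + \<beta> *\<^sub>R (p k - p i) + \<gamma> *\<^sub>R (p l - p i) = 0"
  shows "\<alpha> = 0 \<and> \<beta> = 0 \<and> \<gamma> = 0"
proof -
  have d: "i \<noteq> j" "i \<noteq> k" "i \<noteq> l" "j \<noteq> k" "j \<noteq> l" "k \<noteq> l"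
    using assms(2) by (auto simp: card_insert_if split: if_splits)
  define x where "x = (\<lambda>a. if a = j then \<alpha> else if a = k then \<beta> else \<gamma>)"
  have D: "{i, j, k, l} - {i} = {j, k, l}" using d by auto
  have "(\<Sum>a\<in>{i, j, k, l} - {i}. x a *\<^sub>R (p a - p i)) = 0"
    unfolding D using d assms(3) by (simp add: x_def add.assoc)
  from realizes_combination_eq_0[OF assms(1) _ this] have "x a = 0" if "a \<in> {j, k, l}" for a
    using that unfolding D by blast
  from this[of j] this[of k] this[of l] show ?thesis using d by (auto simp: x_def)
qed


section \<open>Height vectors of a tetrahedron\<close>

text \<open>The altitude from \<open>l\<close> onto the face \<open>{i, j, k}\<close> as a vector, obtained by projecting
  successively along the edge \<open>{i, j}\<close> and along the altitude of the face. Defined this way it is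
  directly comparable with the projections that define the dihedral angle at \<open>{i, j}\<close>.\<close>

definition height_vector :: "('v \<Rightarrow> 'a::real_inner) \<Rightarrow> 'v \<Rightarrow> 'v \<Rightarrow> 'v \<Rightarrow> 'v \<Rightarrow> 'a" where
  "height_vector p i j k l =
     perp (perp (p j - p i) (p k - p i)) (perp (p j - p i) (p l - p i))"

lemma inner_perp_self [simp]: "e \<bullet> perp e x = 0" "perp e x \<bullet> e = 0"
  by (simp_all add: perp_def inner_diff_right inner_diff_left inner_commute)

lemma perp_combination:
  assumes "z \<bullet> e = 0"
  shows "perp e (\<alpha> *\<^sub>R e + \<beta> *\<^sub>R a + z) = \<beta> *\<^sub>R perp e a + z"
  using assms by (cases "e = 0") 
    (simp_all add: perp_def inner_add_left add_divide_distrib algebra_simps)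

text \<open>The altitude is the part of \<open>p l - p i\<close> that remains after splitting off a vector of the face
  plane; with \<open>height_vector_inner\<close> and \<open>height_vector_decomposition\<close> this characterizes it without
  reference to the edge from which the projection starts.\<close>

lemma height_vector_unique:
  assumes "z \<bullet> (p j - p i) = 0" "z \<bullet> (p k - p i) = 0"
    "p l - p i = \<alpha> *\<^sub>R (p j - p i) + \<beta> *\<^sub>R (p k - p i) + z"
  shows "height_vector p i j k l = z"
proof -
  define x where "x = perp (p j - p i) (p k - p i)"
  have "z \<bullet> x = 0" using assms(1,2) by (simp add: x_def perp_def inner_diff_right)
  then have "perp x (0 *\<^sub>R x + \<beta> *\<^sub>R x + z) = \<beta> *\<^sub>R perp x x + z"
    by (rule perp_combination)
  moreover have "perp x x = 0" by (simp add: perp_def)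
  ultimately show ?thesis
    unfolding height_vector_def assms(3) perp_combination[OF assms(1)] by (simp flip: x_def)
qed

lemma height_vector_inner:
  shows "height_vector p i j k l \<bullet> (p j - p i) = 0" "height_vector p i j k l \<bullet> (p k - p i) = 0"
proof -
  define e where "e = p j - p i"
  define x where "x = perp e (p k - p i)"
  define y where "y = perp e (p l - p i)"
  have w: "height_vector p i j k l = perp x y" by (simp add: height_vector_def e_def x_def y_def)
  have "x \<bullet> e = 0" "y \<bullet> e = 0" by (simp_all add: x_def y_def)
  then have "perp x y \<bullet> e = 0" by (simp add: perp_def[of x y] inner_diff_left)
  then show 1: "height_vector p i j k l \<bullet> (p j - p i) = 0" by (simp add: w e_def)
  have "p k - p i = x + (((p k - p i) \<bullet> e) / (e \<bullet> e)) *\<^sub>R e" by (simp add: x_def perp_def)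
  moreover have "perp x y \<bullet> x = 0" by simp
  ultimately show "height_vector p i j k l \<bullet> (p k - p i) = 0"
    using 1 unfolding w e_def[symmetric] by (metis add.right_neutral inner_add_right inner_scaleR_right mult_zero_right)
qed

lemma height_vector_decomposition:
  obtains \<alpha> \<beta> where
    "p l - p i = \<alpha> *\<^sub>R (p j - p i) + \<beta> *\<^sub>R (p k - p i) + height_vector p i j k l"
proof -
  define e where "e = p j - p i"
  define a where "a = p k - p i"
  define b where "b = p l - p i"
  obtain s where s: "perp e a = a - s *\<^sub>R e" using perp_def by blast
  obtain r where r: "perp e b = b - r *\<^sub>R e" using perp_def by blast
  obtain t where t: "perp (perp e a) (perp e b) = perp e b - t *\<^sub>R perp e a" using perp_def by blast
  have "height_vector p i j k l = perp (perp e a) (perp e b)" by (simp add: height_vector_def e_def a_def b_def)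
  then have "height_vector p i j k l = b - r *\<^sub>R e - t *\<^sub>R (a - s *\<^sub>R e)"
    using t unfolding s r by simp
  then have "b = (r - t * s) *\<^sub>R e + t *\<^sub>R a + height_vector p i j k l"
    by (simp add: algebra_simps)
  then show ?thesis using that unfolding a_def b_def e_def by blast
qed

text \<open>By the characterization, all three edges of the face yield the same vector.\<close>

lemma height_vector_rotate: "height_vector p j k i l = height_vector p i j k l"
proof -
  obtain \<alpha> \<beta> where d:
    "p l - p i = \<alpha> *\<^sub>R (p j - p i) + \<beta> *\<^sub>R (p k - p i) + height_vector p i j k l"
    by (rule height_vector_decomposition)
  show ?thesis
  proof (rule height_vector_unique)
    show "height_vector p i j k l \<bullet> (p k - p j) = 0" "height_vector p i j k l \<bullet> (p i - p j) = 0"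
      using height_vector_inner[of p i j k l] by (simp_all add: inner_diff_right)
    have "p l - p j = (p l - p i) - (p j - p i)" by simp
    also have "\<dots> = \<beta> *\<^sub>R (p k - p j) + (1 - \<alpha> - \<beta>) *\<^sub>R (p i - p j) + height_vector p i j k l"
      unfolding d by (simp add: algebra_simps)
    finally show "p l - p j = \<beta> *\<^sub>R (p k - p j) + (1 - \<alpha> - \<beta>) *\<^sub>R (p i - p j) + height_vector p i j k l" .
  qed
qed

lemma height_vector_nonzero:
  assumes "realizes p {i, j, k, l} len" "card {i, j, k, l} = 4"
  shows "height_vector p i j k l \<noteq> 0" 
proof
  assume 0: "height_vector p i j k l = 0"
  obtain \<alpha> \<beta> where
    "p l - p i = \<alpha> *\<^sub>R (p j - p i) + \<beta> *\<^sub>R (p k - p i) + height_vector p i j k l"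
    by (rule height_vector_decomposition)
  then have "(-\<alpha>) *\<^sub>R (p j - p i) + (-\<beta>) *\<^sub>R (p k - p i) + 1 *\<^sub>R (p l - p i) = 0"
    using 0 by (simp add: algebra_simps)
  from tetrahedron_combination_eq_0[OF assms this] show False by simp
qed

lemma perp_edge_nonzero:
  assumes "realizes p {i, j, k, l} len" "card {i, j, k, l} = 4"
  shows "perp (p j - p i) (p k - p i) \<noteq> 0"
proof
  obtain s where s: "perp (p j - p i) (p k - p i) = (p k - p i) - s *\<^sub>R (p j - p i)"
    using perp_def by blast
  assume "perp (p j - p i) (p k - p i) = 0"
  then have "(-s) *\<^sub>R (p j - p i) + 1 *\<^sub>R (p k - p i) + 0 *\<^sub>R (p l - p i) = 0"
    using s by simp
  from tetrahedron_combination_eq_0[OF assms this] show False by simp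
qed

text \<open>Base times height of the parallelogram spanned by the two projections.\<close>

lemma norm_height_vector:
  fixes p :: "'v \<Rightarrow> 'a::real_inner"
  assumes "x = perp (p j - p i) (p k - p i)" "y = perp (p j - p i) (p l - p i)" "x \<noteq> 0"
  shows "norm x * norm (height_vector p i j k l) = sqrt ((x \<bullet> x) * (y \<bullet> y) - (x \<bullet> y)\<^sup>2)"
proof -
  have "(x \<bullet> x) * (height_vector p i j k l \<bullet> height_vector p i j k l) = (x \<bullet> x) * (y \<bullet> y) - (x \<bullet> y)\<^sup>2"
    unfolding height_vector_def assms(1,2)[symmetric] inner_perp
    using assms(3) by (simp add: field_simps power2_eq_square inner_commute)
  then show ?thesis by (simp add: norm_eq_sqrt_inner flip: real_sqrt_mult)
qed


section \<open>Variation of dihedral angles\<close>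

text \<open>The angular velocity at which the face \<open>{i, j, k}\<close> turns about its edge \<open>{i, j}\<close> towards \<open>l\<close>
  when the vertices move with velocities \<open>V\<close>: the velocity of \<open>k\<close> relative to the foot of its
  altitude, measured along the unit normal, and divided by the length of that altitude.\<close>

definition face_rotation ::
  "('v \<Rightarrow> 'a::real_inner) \<Rightarrow> ('v \<Rightarrow> 'a) \<Rightarrow> 'v \<Rightarrow> 'v \<Rightarrow> 'v \<Rightarrow> 'v \<Rightarrow> real" where
  "face_rotation p V i j k l =
     (let e = p j - p i; a = p k - p i; w = height_vector p i j k l
      in w \<bullet> ((V k - V i) - ((a \<bullet> e) / (e \<bullet> e)) *\<^sub>R (V j - V i)) / (norm (perp e a) * norm w))"

text \<open>The inner product of the edge vectors from \<open>i\<close> to \<open>a\<close> and \<open>b\<close>, expressed by the law of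
  cosines. The case \<open>a = b\<close> is separate because \<open>len $ {a}\<close> is not assumed to vanish.\<close>

definition edge_inner :: "real ^ ('v::finite set) \<Rightarrow> 'v \<Rightarrow> 'v \<Rightarrow> 'v \<Rightarrow> real" where
  "edge_inner len i a b =
     (if a = b then (len $ {i, a})\<^sup>2
      else ((len $ {i, a})\<^sup>2 + (len $ {i, b})\<^sup>2 - (len $ {a, b})\<^sup>2) / 2)"

text \<open>The inner product of the projections of the edge vectors to \<open>k\<close> and \<open>l\<close> onto the complement
  of the edge \<open>{i, j}\<close>. In this form the dihedral angle is an explicit function of the lengths and
  can be differentiated without choosing realizations that depend smoothly on the lengths.\<close>

definition perp_inner :: "real ^ ('v::finite set) \<Rightarrow> 'v \<Rightarrow> 'v \<Rightarrow> 'v \<Rightarrow> 'v \<Rightarrow> real" where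
  "perp_inner len i j k l =
     edge_inner len i k l - edge_inner len i k j * edge_inner len i l j / edge_inner len i j j"

lemma realizes_edge_inner:
  assumes "realizes p \<sigma> len" "i \<in> \<sigma>" "a \<in> \<sigma>" "b \<in> \<sigma>" "a \<noteq> i" "b \<noteq> i"
  shows "(p a - p i) \<bullet> (p b - p i) = edge_inner len i a b"
proof (cases "a = b")
  case True
  then show ?thesis using realizes_dist(3)[OF assms(1), of a i] assms
    by (simp add: edge_inner_def insert_commute)
next
  case False
  have "dist (p a) (p b) = len $ {a, b}" "dist (p i) (p a) = len $ {i, a}" "dist (p i) (p b) = len $ {i, b}"
    using assms False by (auto simp: realizes_def)
  then show ?thesis using False by (simp add: inner_diff_dist edge_inner_def)
qed

lemma realizes_perp_inner:
  assumes "realizes p {i, j, k, l} len" "i \<noteq> j" "i \<noteq> k" "i \<noteq> l"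
    "a \<in> {k, l}" "b \<in> {k, l}"
  shows "perp (p j - p i) (p a - p i) \<bullet> perp (p j - p i) (p b - p i) = perp_inner len i j a b"
  unfolding inner_perp perp_inner_def
  using assms by (subst (1 2 3 4) realizes_edge_inner[OF assms(1)]) auto

lemma dihedral_angle_eq_arccos:
  assumes "realizes p {i, j, k, l} len" "i \<noteq> j" "i \<noteq> k" "i \<noteq> l"
  shows "dihedral_angle len i j k l =
    arccos (perp_inner len i j k l / (sqrt (perp_inner len i j k k) * sqrt (perp_inner len i j l l)))"
  unfolding dihedral_angle_realization[OF assms(1)] vangle_def norm_eq_sqrt_inner
  using realizes_perp_inner[OF assms] by simp

lemma has_derivative_arccos_quotient:
  fixes X Y Z :: "'a::real_normed_vector \<Rightarrow> real"
  assumes "(X has_derivative X') (at x)" "(Y has_derivative Y') (at x)" "(Z has_derivative Z') (at x)"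
    and pos: "0 < X x" "0 < Y x" "(Z x)\<^sup>2 < X x * Y x"
  shows "((\<lambda>y. arccos (Z y / (sqrt (X y) * sqrt (Y y)))) has_derivative
    (\<lambda>h. - (Z' h - Z x * (X' h / (2 * X x) + Y' h / (2 * Y x))) / sqrt (X x * Y x - (Z x)\<^sup>2))) (at x)"
proof -
  define r where "r = Z x / (sqrt (X x) * sqrt (Y x))"
  have s: "sqrt (X x) > 0" "sqrt (Y x) > 0" using pos by auto
  have r2: "r\<^sup>2 = (Z x)\<^sup>2 / (X x * Y x)"
    using pos by (simp add: r_def power_divide power_mult_distrib)
  then have r1: "r\<^sup>2 < 1" using pos by simp
  then have r: "-1 < r" "r < 1" by (simp_all add: abs_square_less_1 abs_less_iff)
  have "1 - r\<^sup>2 = (X x * Y x - (Z x)\<^sup>2) / (X x * Y x)" unfolding r2 using pos by (simp add: field_simps)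
  then have sq: "sqrt (1 - r\<^sup>2) = sqrt (X x * Y x - (Z x)\<^sup>2) / (sqrt (X x) * sqrt (Y x))"
    by (simp add: real_sqrt_divide real_sqrt_mult)
  have S: "sqrt (X x * Y x - (Z x)\<^sup>2) > 0" using pos by simp
  have quot: "((\<lambda>y. Z y / (sqrt (X y) * sqrt (Y y))) has_derivative
    (\<lambda>h. (Z' h - Z x * (X' h / (2 * X x) + Y' h / (2 * Y x))) / (sqrt (X x) * sqrt (Y x)))) (at x)"
    apply (rule derivative_eq_intros assms refl | use pos in force)+
    apply (rule ext)
    subgoal for h
    proof -
      define \<alpha> \<beta> where "\<alpha> = sqrt (X x)" and "\<beta> = sqrt (Y x)"
      have eq: "X x = \<alpha>\<^sup>2" "Y x = \<beta>\<^sup>2" "\<alpha> \<noteq> 0" "\<beta> \<noteq> 0" using pos by (auto simp: \<alpha>_def \<beta>_def)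
      show ?thesis unfolding \<alpha>_def[symmetric] \<beta>_def[symmetric] unfolding eq(1,2) using eq(3,4)
        by (simp add: field_simps power2_eq_square)
    qed
    done
  show ?thesis
    apply (rule has_derivative_eq_rhs[OF has_derivative_arccos[OF _ _ quot]])
      apply (use r in \<open>simp_all add: r_def\<close>)[2]
    apply (rule ext)
    unfolding r_def[symmetric] sq using s S by (simp add: field_simps)
qed

lemma edge_inner_has_derivative:
  fixes len :: "'b::real_normed_vector \<Rightarrow> real ^ ('v::finite set)"
  assumes der: "(len has_derivative len') (at x)"
    and V: "\<And>h a b. a \<in> \<sigma> \<Longrightarrow> b \<in> \<sigma> \<Longrightarrow> a \<noteq> b \<Longrightarrow>
      (p a - p b) \<bullet> (V h a - V h b) = len x $ {a, b} * len' h $ {a, b}"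
    and "i \<in> \<sigma>" "a \<in> \<sigma>" "b \<in> \<sigma>" "a \<noteq> i" "b \<noteq> i"
  shows "((\<lambda>y. edge_inner (len y) i a b) has_derivative
    (\<lambda>h. (p a - p i) \<bullet> (V h b - V h i) + (p b - p i) \<bullet> (V h a - V h i))) (at x)"
proof -
  have c: "((\<lambda>y. (len y $ {s, t})\<^sup>2) has_derivative
      (\<lambda>h. 2 * ((p s - p t) \<bullet> (V h s - V h t)))) (at x)"
    if "s \<in> \<sigma>" "t \<in> \<sigma>" "s \<noteq> t" for s t
    unfolding V[OF that]
    by (rule derivative_eq_intros bounded_linear.has_derivative[OF bounded_linear_vec_nth der] refl | simp add: mult_ac)+
  show ?thesis
  proof (cases "a = b")
    case True
    then show ?thesis unfolding edge_inner_def using c[of a i] assms(3,4,6)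
      by (simp add: insert_commute)
  next
    case False
    have "((\<lambda>y. ((len y $ {i, a})\<^sup>2 + (len y $ {i, b})\<^sup>2 - (len y $ {a, b})\<^sup>2) / 2) has_derivative
      (\<lambda>h. (2 * ((p i - p a) \<bullet> (V h i - V h a)) + 2 * ((p i - p b) \<bullet> (V h i - V h b))
         - 2 * ((p a - p b) \<bullet> (V h a - V h b))) / 2)) (at x)"
      using assms False
      by (intro bounded_linear.has_derivative[OF bounded_linear_divide] has_derivative_add has_derivative_diff c) auto
    then have "((\<lambda>y. edge_inner (len y) i a b) has_derivative
      (\<lambda>h. (2 * ((p i - p a) \<bullet> (V h i - V h a)) + 2 * ((p i - p b) \<bullet> (V h i - V h b))
         - 2 * ((p a - p b) \<bullet> (V h a - V h b))) / 2)) (at x)"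
      using False by (simp add: edge_inner_def)
    then show ?thesis
      by (rule has_derivative_eq_rhs)
        (simp add: fun_eq_iff inner_diff_left inner_diff_right field_simps)
  qed
qed

text \<open>Differentiating \<open>perp e a\<close> also moves the projection coefficient, but that contributes a
  multiple of \<open>e\<close>, which the other projection does not see. Hence only the velocity \<open>W\<close> of \<open>a\<close>
  relative to its foot on the edge enters.\<close>

lemma perp_inner_has_derivative:
  fixes len :: "'b::real_normed_vector \<Rightarrow> real ^ ('v::finite set)"
  assumes der: "(len has_derivative len') (at x)"
    and p: "realizes p \<sigma> (len x)"
    and V: "\<And>h a b. a \<in> \<sigma> \<Longrightarrow> b \<in> \<sigma> \<Longrightarrow> a \<noteq> b \<Longrightarrow>
      (p a - p b) \<bullet> (V h a - V h b) = len x $ {a, b} * len' h $ {a, b}"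
    and mem: "i \<in> \<sigma>" "j \<in> \<sigma>" "a \<in> \<sigma>" "b \<in> \<sigma>" "j \<noteq> i" "a \<noteq> i" "b \<noteq> i"
  defines "e \<equiv> p j - p i"
  defines "W \<equiv> (\<lambda>h a. (V h a - V h i) - (((p a - p i) \<bullet> e) / (e \<bullet> e)) *\<^sub>R (V h j - V h i))"
  shows "((\<lambda>y. perp_inner (len y) i j a b) has_derivative
    (\<lambda>h. perp e (p a - p i) \<bullet> W h b + perp e (p b - p i) \<bullet> W h a)) (at x)"
proof -
  have E: "((\<lambda>y. edge_inner (len y) i s t) has_derivative
      (\<lambda>h. (p s - p i) \<bullet> (V h t - V h i) + (p t - p i) \<bullet> (V h s - V h i))) (at x)"
    if "s \<in> \<sigma>" "t \<in> \<sigma>" "s \<noteq> i" "t \<noteq> i" for s t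
    by (rule edge_inner_has_derivative[OF der, where \<sigma> = \<sigma>]) (use V mem that in auto)
  have val: "edge_inner (len x) i s t = (p s - p i) \<bullet> (p t - p i)"
    if "s \<in> \<sigma>" "t \<in> \<sigma>" "s \<noteq> i" "t \<noteq> i" for s t
    using realizes_edge_inner[OF p] that mem by auto
  have e: "e \<bullet> e \<noteq> 0" using realizes_dist(2,3)[OF p, of j i] mem by (auto simp: e_def)
  define s where "s = (\<lambda>a. ((p a - p i) \<bullet> e) / (e \<bullet> e))"
  have s: "(p a - p i) \<bullet> e = s a * (e \<bullet> e)" for a using e by (simp add: s_def)
  show ?thesis
    unfolding perp_inner_def
    apply (rule has_derivative_eq_rhs[OF has_derivative_diff[OF E[OF mem(3,4,6,7)]
        has_derivative_divide[OF has_derivative_mult[OF E[OF mem(3,2,6,5)] E[OF mem(4,2,7,5)]]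
          E[OF mem(2,2,5,5)]]]])
    subgoal using e val[of j j] mem by (simp add: e_def)
    apply (rule ext)
    subgoal for h
    proof -
      define a' b' e' where "a' = V h a - V h i" and "b' = V h b - V h i" and "e' = V h j - V h i"
      have W: "W h a = a' - s a *\<^sub>R e'" "W h b = b' - s b *\<^sub>R e'"
        by (simp_all add: W_def s_def a'_def b'_def e'_def)
      define A B E where "A = p a - p i" and "B = p b - p i" and "E = e \<bullet> e"
      have P: "perp e A = A - s a *\<^sub>R e" "perp e B = B - s b *\<^sub>R e"
        by (simp_all add: perp_def s_def A_def B_def)
      have E: "E \<noteq> 0" using e by (simp add: E_def)
      have v: "edge_inner (len x) i a j = s a * E" "edge_inner (len x) i b j = s b * E"
        "edge_inner (len x) i j j = E"
        using val[of a j] val[of b j] val[of j j] mem s by (simp_all add: E_def flip: e_def)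
      have sE: "A \<bullet> e = s a * E" "B \<bullet> e = s b * E" by (simp_all add: A_def B_def E_def s)
      show ?thesis
        unfolding v W e_def[symmetric] A_def[symmetric] B_def[symmetric] P
          a'_def[symmetric] b'_def[symmetric] e'_def[symmetric]
        by (simp add: inner_diff_left inner_diff_right E divide_simps) (simp add: algebra_simps)
    qed
    done
qed

text \<open>The dihedral angle is the opening between its two faces, each of which closes it at the rate
  of its own rotation. Any velocities that induce the given variation of lengths may be used.\<close>

lemma dihedral_angle_has_derivative:
  fixes len :: "'b::real_normed_vector \<Rightarrow> real ^ ('v::finite set)"
  assumes der: "(len has_derivative len') (at x)"
    and ev: "\<forall>\<^sub>F y in nhds x. \<exists>q. realizes q {i, j, k, l} (len y)"
    and card: "card {i, j, k, l} = 4"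
    and p: "realizes p {i, j, k, l} (len x)"
    and V: "\<And>h a b. a \<in> {i, j, k, l} \<Longrightarrow> b \<in> {i, j, k, l} \<Longrightarrow> a \<noteq> b \<Longrightarrow>
      (p a - p b) \<bullet> (V h a - V h b) = len x $ {a, b} * len' h $ {a, b}"
  shows "((\<lambda>y. dihedral_angle (len y) i j k l) has_derivative
    (\<lambda>h. - (face_rotation p (V h) i j k l + face_rotation p (V h) i j l k))) (at x)"
proof -
  have d: "i \<noteq> j" "i \<noteq> k" "i \<noteq> l" using card by (auto simp: card_insert_if split: if_splits)
  have p': "realizes p {i, j, l, k} (len x)" and card': "card {i, j, l, k} = 4"
    using p card by (simp_all add: insert_commute)
  define e where "e = p j - p i"
  define u where "u = perp e (p k - p i)"
  define v where "v = perp e (p l - p i)"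
  define W where "W = (\<lambda>h a. (V h a - V h i) - (((p a - p i) \<bullet> e) / (e \<bullet> e)) *\<^sub>R (V h j - V h i))"
  have P: "((\<lambda>y. perp_inner (len y) i j a b) has_derivative
      (\<lambda>h. perp e (p a - p i) \<bullet> W h b + perp e (p b - p i) \<bullet> W h a)) (at x)"
    if "a \<in> {k, l}" "b \<in> {k, l}" for a b
    unfolding e_def W_def
    by (rule perp_inner_has_derivative[OF der p], erule (2) V) (use d that in auto)
  have uv: "perp_inner (len x) i j k k = u \<bullet> u" "perp_inner (len x) i j l l = v \<bullet> v"
     "perp_inner (len x) i j k l = u \<bullet> v"
    using realizes_perp_inner[OF p d] by (simp_all add: u_def v_def e_def)
  have nz: "u \<noteq> 0" "v \<noteq> 0"
    using perp_edge_nonzero[OF p card] perp_edge_nonzero[OF p' card'] by (simp_all add: u_def v_def e_def)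
  have na: "norm u * norm (height_vector p i j k l) = sqrt ((u \<bullet> u) * (v \<bullet> v) - (u \<bullet> v)\<^sup>2)"
    "norm v * norm (height_vector p i j l k) = sqrt ((u \<bullet> u) * (v \<bullet> v) - (u \<bullet> v)\<^sup>2)"
    using norm_height_vector[of u p j i k v l] norm_height_vector[of v p j i l u k] nz
    by (simp_all add: u_def v_def e_def inner_commute mult.commute)
  have "0 < norm u * norm (height_vector p i j k l)" using nz height_vector_nonzero[OF p card] by simp
  then have lt: "(u \<bullet> v)\<^sup>2 < (u \<bullet> u) * (v \<bullet> v)" unfolding na by simp
  have "((\<lambda>y. arccos (perp_inner (len y) i j k l /
        (sqrt (perp_inner (len y) i j k k) * sqrt (perp_inner (len y) i j l l)))) has_derivative
    (\<lambda>h. - ((u \<bullet> W h l + v \<bullet> W h k) - (u \<bullet> v) *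
       ((u \<bullet> W h k + u \<bullet> W h k) / (2 * (u \<bullet> u)) + (v \<bullet> W h l + v \<bullet> W h l) / (2 * (v \<bullet> v))))
       / sqrt ((u \<bullet> u) * (v \<bullet> v) - (u \<bullet> v)\<^sup>2))) (at x)"
    unfolding uv[symmetric]
    by (rule has_derivative_arccos_quotient)
       (use P[of k k] P[of l l] P[of k l] nz lt in \<open>simp_all add: uv flip: u_def v_def\<close>)
  moreover have "\<forall>\<^sub>F y in at x. arccos (perp_inner (len y) i j k l /
        (sqrt (perp_inner (len y) i j k k) * sqrt (perp_inner (len y) i j l l)))
        = dihedral_angle (len y) i j k l"
    using ev unfolding eventually_nhds_conv_at
    by (auto elim!: eventually_mono simp: dihedral_angle_eq_arccos[OF _ d])
  ultimately have "((\<lambda>y. dihedral_angle (len y) i j k l) has_derivative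
    (\<lambda>h. - ((u \<bullet> W h l + v \<bullet> W h k) - (u \<bullet> v) *
       ((u \<bullet> W h k + u \<bullet> W h k) / (2 * (u \<bullet> u)) + (v \<bullet> W h l + v \<bullet> W h l) / (2 * (v \<bullet> v))))
       / sqrt ((u \<bullet> u) * (v \<bullet> v) - (u \<bullet> v)\<^sup>2))) (at x)"
    by (rule has_derivative_transform_eventually)
       (use dihedral_angle_eq_arccos[OF p d] in simp_all)
  moreover have R1: "face_rotation p (V h) i j k l = 
      (v \<bullet> W h k - (u \<bullet> v) * (u \<bullet> W h k) / (u \<bullet> u)) / sqrt ((u \<bullet> u) * (v \<bullet> v) - (u \<bullet> v)\<^sup>2)" for h
  proof -
    have "height_vector p i j k l = v - ((u \<bullet> v) / (u \<bullet> u)) *\<^sub>R u"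
      unfolding height_vector_def u_def v_def e_def by (simp add: perp_def[of "perp _ _"] inner_commute)
    then show ?thesis unfolding na(1)[symmetric]
      by (simp add: face_rotation_def Let_def u_def W_def e_def inner_diff_left)
  qed
  moreover have R2: "face_rotation p (V h) i j l k = 
      (u \<bullet> W h l - (u \<bullet> v) * (v \<bullet> W h l) / (v \<bullet> v)) / sqrt ((u \<bullet> u) * (v \<bullet> v) - (u \<bullet> v)\<^sup>2)" for h
  proof -
    have "height_vector p i j l k = u - ((u \<bullet> v) / (v \<bullet> v)) *\<^sub>R v"
      unfolding height_vector_def u_def v_def e_def by (simp add: perp_def[of "perp _ _"])
    then show ?thesis unfolding na(2)[symmetric]
      by (simp add: face_rotation_def Let_def v_def W_def e_def inner_diff_left)
  qed
  moreover have "- ((ul + vk) - m * ((uk + uk) / (2 * U) + (vl + vl) / (2 * V))) / S =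
      - ((vk - m * uk / U) / S + (ul - m * vl / V) / S)" for ul vk m uk vl U V S :: real
    by (simp add: add_divide_distrib diff_divide_distrib distrib_left)
  ultimately show ?thesis by (simp only:)
qed


section \<open>The Schlaefli identity of a face\<close>

text \<open>With \<open>\<mu> m\<close> the normal velocity of vertex \<open>m\<close>, this is the normal derivative of the affine
  interpolation of \<open>\<mu>\<close> across the edge. The weights \<open>gi\<close> and \<open>gj\<close> locate the foot of the altitude
  on the edge, and \<open>D\<close> is twice the area of the face.\<close>

lemma face_rotation_barycentric:
  fixes V :: "'v::finite \<Rightarrow> real ^ 'v"
  assumes p: "realizes p {i, j, k, l} len" and card: "card {i, j, k, l} = 4"
  defines "w \<equiv> height_vector p i j k l"
  defines "\<mu> \<equiv> (\<lambda>m. (w \<bullet> V m) / norm w)"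
  defines "gi \<equiv> (p j - p i) \<bullet> (p k - p i)" and "gj \<equiv> (p k - p j) \<bullet> (p i - p j)"
  defines "D \<equiv> norm (p j - p i) * norm (perp (p j - p i) (p k - p i))"
  shows "face_rotation p V i j k l =
    ((gi + gj) * \<mu> k - gj * \<mu> i - gi * \<mu> j) / (norm (p j - p i) * D)"
proof -
  define e where "e = p j - p i"
  define a where "a = p k - p i"
  have d: "i \<noteq> j" using card by (auto simp: card_insert_if split: if_splits)
  have ne: "norm e \<noteq> 0" using realizes_dist(1,2)[OF p, of j i] d by (auto simp: e_def)
  have ee: "e \<bullet> e = norm e * norm e" by (simp add: dot_square_norm power2_eq_square)
  have g: "gi = a \<bullet> e" "gi + gj = e \<bullet> e"
    by (simp_all add: gi_def gj_def e_def a_def inner_diff_left inner_diff_right inner_commute)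
  have w: "norm w \<noteq> 0" using height_vector_nonzero[OF p card] by (simp add: w_def)
  have "face_rotation p V i j k l = (w \<bullet> V k - w \<bullet> V i - gi / (gi + gj) * (w \<bullet> V j - w \<bullet> V i)) /
      (norm (perp e a) * norm w)"
    unfolding g(2) unfolding g(1)
    by (simp add: face_rotation_def Let_def w_def e_def a_def inner_diff_right)
  also have "\<dots> = (\<mu> k - \<mu> i - gi / (gi + gj) * (\<mu> j - \<mu> i)) / norm (perp e a)"
    using w by (simp add: \<mu>_def divide_simps)
  also have "\<dots> = ((gi + gj) * \<mu> k - gj * \<mu> i - gi * \<mu> j) / ((gi + gj) * norm (perp e a))"
  proof -
    have "gi + gj \<noteq> 0" using ne by (simp add: g(2))
    moreover have "(z - x - g / (g + g') * (y - x)) / n = ((g + g') * z - g' * x - g * y) / ((g + g') * n)"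
      if "g + g' \<noteq> 0" for x y z g g' n :: real
    proof -
      have "(g + g') * (z - x - g / (g + g') * (y - x)) = (g + g') * z - g' * x - g * y"
        using that by (simp add: right_diff_distrib) (simp add: algebra_simps)
      then show ?thesis using that by (metis mult_divide_mult_cancel_left)
    qed
    ultimately show ?thesis by blast
  qed
  also have "(gi + gj) * norm (perp e a) = norm e * D"
    using g(2) ee by (simp add: D_def e_def a_def)
  finally show ?thesis by (simp add: e_def)
qed

text \<open>Both sides are twice the area of the triangle.\<close>

lemma triangle_area_rotate:
  fixes p :: "'v \<Rightarrow> 'a::real_inner"
  assumes "p i \<noteq> p j" "p j \<noteq> p k"
  shows "norm (p k - p j) * norm (perp (p k - p j) (p i - p j)) =
    norm (p j - p i) * norm (perp (p j - p i) (p k - p i))"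
proof -
  have *: "norm e * norm (perp e a) = sqrt ((e \<bullet> e) * (a \<bullet> a) - (a \<bullet> e)\<^sup>2)"
    if "e \<noteq> 0" for e a :: 'a
    using that unfolding norm_eq_sqrt_inner inner_perp
    by (simp add: power2_eq_square right_diff_distrib flip: real_sqrt_mult)
  show ?thesis
    using assms
    by (subst (1 2) *) (simp_all add: inner_diff_left inner_diff_right inner_commute
        power2_eq_square algebra_simps)
qed

text \<open>The three rotations of one face share the normal velocities and the area, so they can be
  added.\<close>

lemma face_rotation_cycle:
  fixes V :: "'v::finite \<Rightarrow> real ^ 'v"
  assumes p: "realizes p {i, j, k, l} len" and card: "card {i, j, k, l} = 4"
  defines "\<mu> \<equiv> (\<lambda>m. (height_vector p i j k l \<bullet> V m) / norm (height_vector p i j k l))"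
  defines "gi \<equiv> (p j - p i) \<bullet> (p k - p i)" and "gj \<equiv> (p k - p j) \<bullet> (p i - p j)"
    and "gk \<equiv> (p i - p k) \<bullet> (p j - p k)"
  defines "D \<equiv> norm (p j - p i) * norm (perp (p j - p i) (p k - p i))"
  shows "norm (p j - p i) * face_rotation p V i j k l = ((gi + gj) * \<mu> k - gj * \<mu> i - gi * \<mu> j) / D"
    and "norm (p k - p j) * face_rotation p V j k i l = ((gj + gk) * \<mu> i - gk * \<mu> j - gj * \<mu> k) / D"
    and "norm (p i - p k) * face_rotation p V k i j l = ((gk + gi) * \<mu> j - gi * \<mu> k - gk * \<mu> i) / D"
    and "D > 0"
proof -
  have d: "i \<noteq> j" "i \<noteq> k" "j \<noteq> k" using card by (auto simp: card_insert_if split: if_splits)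
  have p': "realizes p {j, k, i, l} len" "realizes p {k, i, j, l} len" 
    and card': "card {j, k, i, l} = 4" "card {k, i, j, l} = 4"
    using p card by (simp_all add: insert_commute)
  have ne: "p i \<noteq> p j" "p j \<noteq> p k" "p k \<noteq> p i"
    using p d by (auto simp: realizes_def inj_on_def)
  have D: "norm (p k - p j) * norm (perp (p k - p j) (p i - p j)) = D"
    "norm (p i - p k) * norm (perp (p i - p k) (p j - p k)) = D"
    using triangle_area_rotate[of p i j k] triangle_area_rotate[of p j k i] ne by (simp_all add: D_def)
  show "D > 0" using perp_edge_nonzero[OF p card] ne by (simp add: D_def)
  have A: "height_vector p j k i l = height_vector p i j k l" "height_vector p k i j l = height_vector p i j k l"
    using height_vector_rotate[of p] by metis+
  show "norm (p j - p i) * face_rotation p V i j k l = ((gi + gj) * \<mu> k - gj * \<mu> i - gi * \<mu> j) / D"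
    unfolding face_rotation_barycentric[OF p card, of V, folded D_def]
    using ne by (simp add: \<mu>_def gi_def gj_def)
  show "norm (p k - p j) * face_rotation p V j k i l = ((gj + gk) * \<mu> i - gk * \<mu> j - gj * \<mu> k) / D"
    unfolding face_rotation_barycentric[OF p'(1) card'(1), of V, unfolded D A]
    using ne by (simp add: \<mu>_def gj_def gk_def)
  show "norm (p i - p k) * face_rotation p V k i j l = ((gk + gi) * \<mu> j - gi * \<mu> k - gk * \<mu> i) / D"
    unfolding face_rotation_barycentric[OF p'(2) card'(2), of V, unfolded D A]
    using ne by (simp add: \<mu>_def gi_def gk_def)
qed

text \<open>The inward normals of a triangle, weighted by edge length, add up to zero, and so do the
  normal derivatives of an affine function. This is the share of one face in the Schlaefli formula.\<close>

lemma face_rotation_schlaefli: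
  fixes V :: "'v::finite \<Rightarrow> real ^ 'v"
  assumes p: "realizes p {i, j, k, l} len" and card: "card {i, j, k, l} = 4"
  shows "norm (p j - p i) * face_rotation p V i j k l
    + norm (p k - p j) * face_rotation p V j k i l
    + norm (p i - p k) * face_rotation p V k i j l = 0"
proof -
  have "((a + b) * z - b * x - a * y) / D + ((b + c) * x - c * y - b * z) / D
      + ((c + a) * y - a * z - c * x) / D = 0" for a b c x y z D :: real
    unfolding add_divide_distrib[symmetric] by (simp add: algebra_simps)
  then show ?thesis unfolding face_rotation_cycle[OF assms] .
qed


section \<open>Centers\<close>

lemma cos_sin_vangle:
  fixes x y :: "'a::real_inner"
  assumes "x \<noteq> 0" "y \<noteq> 0"
  shows "cos (vangle x y) = x \<bullet> y / (norm x * norm y)"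
    and "sin (vangle x y) = norm (perp x y) / norm y"
proof -
  define r where "r = x \<bullet> y / (norm x * norm y)"
  have "\<bar>r\<bar> \<le> 1" using Cauchy_Schwarz_ineq2[of x y] assms by (simp add: r_def)
  then have r: "-1 \<le> r" "r \<le> 1" by (auto simp: abs_le_iff)
  show "cos (vangle x y) = x \<bullet> y / (norm x * norm y)"
    using r by (simp add: vangle_def flip: r_def)
  have "1 - r\<^sup>2 = (perp x y \<bullet> perp x y) / (y \<bullet> y)"
    using assms unfolding inner_perp r_def
    by (simp add: power_divide power_mult_distrib dot_square_norm field_simps power2_eq_square
        inner_commute)
  moreover have "sin (vangle x y) = sqrt (1 - r\<^sup>2)"
    using r by (simp add: vangle_def sin_arccos flip: r_def)
  ultimately show "sin (vangle x y) = norm (perp x y) / norm y"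
    by (simp add: norm_eq_sqrt_inner real_sqrt_divide)
qed

text \<open>If \<open>m\<close> has components \<open>m \<bullet> x / norm x\<close> and \<open>m \<bullet> y / norm y\<close> along two directions, then the
  formula yields its component along the normal to \<open>x\<close> in the plane of both. The definitions of
  \<open>height2\<close> and \<open>height3\<close> are the instances for a triangle and for the plane orthogonal to an edge.\<close>

lemma component_perp_vangle:
  fixes x y m :: "'a::real_inner"
  assumes "x \<noteq> 0" "y \<noteq> 0" "perp x y \<noteq> 0"
  shows "(m \<bullet> y / norm y - m \<bullet> x / norm x * cos (vangle x y)) / sin (vangle x y) =
    m \<bullet> perp x y / norm (perp x y)"
proof -
  have xx: "x \<bullet> x = norm x * norm x" by (simp add: dot_square_norm power2_eq_square)
  have m: "m \<bullet> perp x y = m \<bullet> y - (x \<bullet> y) / (norm x * norm x) * (m \<bullet> x)"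
    by (simp add: perp_def inner_diff_right xx inner_commute)
  show ?thesis
    unfolding cos_sin_vangle[OF assms(1,2)] m using assms by (simp add: field_simps)
qed

text \<open>The point whose orthogonal projection to the line through \<open>a\<close> and \<open>b\<close> lies at signed
  distance \<open>d $ (a, b)\<close> from \<open>a\<close>.\<close>

definition is_center ::
  "('v::finite \<Rightarrow> real ^ 'v) \<Rightarrow> 'v set \<Rightarrow> real ^ ('v \<times> 'v) \<Rightarrow> real ^ 'v \<Rightarrow> bool" where
  "is_center p \<sigma> d c \<longleftrightarrow>
     (\<forall>a\<in>\<sigma>. \<forall>b\<in>\<sigma>. a \<noteq> b \<longrightarrow> (c - p a) \<bullet> (p b - p a) = d $ (a, b) * norm (p b - p a))"

text \<open>The conditions at one vertex \<open>i\<close> prescribe the inner products of \<open>c - p i\<close> with independent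
  vectors and can be solved. For an edge \<open>{a, b}\<close> away from \<open>i\<close> the condition then is exactly the
  compatibility of \<open>d\<close> on the triangle \<open>{i, a, b}\<close>.\<close>

lemma is_center_exists:
  assumes d: "d \<in> metrics T" and T: "simplicial_complex_on_UNIV T" "\<sigma> \<in> T"
    and p: "realizes p \<sigma> (lengths T d)"
  obtains c where "is_center p \<sigma> d c"
proof -
  have sub: "\<tau> \<in> T" if "\<tau> \<noteq> {}" "\<tau> \<subseteq> \<sigma>" for \<tau>
    using T that by (auto simp: simplicial_complex_on_UNIV_def)
  have len: "norm (p b - p a) = d $ (a, b) + d $ (b, a)" if "a \<in> \<sigma>" "b \<in> \<sigma>" "a \<noteq> b" for a b
  proof -
    have "(a, b) \<in> directed_edges T" using that sub[of "{a, b}"] by (auto simp: directed_edges_def)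
    then show ?thesis using realizes_dist(1)[OF p, of a b] that lengths_edge[of a b T d]
      by (simp add: norm_minus_commute)
  qed
  have "\<sigma> \<noteq> {}" using T by (auto simp: simplicial_complex_on_UNIV_def)
  then obtain i where i: "i \<in> \<sigma>" by auto
  obtain w where w: "\<And>a. a \<in> \<sigma> - {i} \<Longrightarrow> w \<bullet> (p a - p i) = d $ (i, a) * norm (p a - p i)"
    using realizes_prescribed_inner[OF p i, of "\<lambda>a. d $ (i, a) * norm (p a - p i)"] by blast
  define c where "c = p i + w"
  have ci: "(c - p i) \<bullet> (p a - p i) = d $ (i, a) * norm (p a - p i)" if "a \<in> \<sigma>" for a
    using w[of a] that by (cases "a = i") (simp_all add: c_def)
  have sq: "(p b - p a) \<bullet> (p b - p a) = (norm (p b - p a))\<^sup>2" for a b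
    by (simp add: power2_norm_eq_inner)
  have "(c - p a) \<bullet> (p b - p a) = d $ (a, b) * norm (p b - p a)"
    if ab: "a \<in> \<sigma>" "b \<in> \<sigma>" "a \<noteq> b" for a b
  proof -
    consider "a = i" | "b = i" "a \<noteq> i" | "a \<noteq> i" "b \<noteq> i" by blast
    then show ?thesis
    proof cases
      case 1
      then show ?thesis using ci ab by simp
    next
      case 2
      have "(c - p a) \<bullet> (p i - p a) = (p a - p i) \<bullet> (p a - p i) - (c - p i) \<bullet> (p a - p i)"
        by (simp add: inner_diff_left inner_diff_right inner_commute)
      also have "\<dots> = d $ (a, i) * norm (p a - p i)"
        unfolding ci[OF ab(1)] sq len[OF i ab(1) 2(2)[symmetric]]
        by (simp add: power2_eq_square algebra_simps)
      finally show ?thesis using 2 by (simp add: norm_minus_commute)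
    next
      case 3
      define A B E where "A = norm (p a - p i)" and "B = norm (p b - p i)" and "E = norm (p b - p a)"
      have "{i, a, b} \<in> T" "card {i, a, b} = 3" using sub[of "{i, a, b}"] 3 ab i by auto
      then have tri: "(d $ (i, a))\<^sup>2 + (d $ (a, b))\<^sup>2 + (d $ (b, i))\<^sup>2 =
          (d $ (a, i))\<^sup>2 + (d $ (i, b))\<^sup>2 + (d $ (b, a))\<^sup>2"
        using d by (auto simp: metrics_def)
      have L: "A = d $ (i, a) + d $ (a, i)" "B = d $ (i, b) + d $ (b, i)" "E = d $ (a, b) + d $ (b, a)"
        using len ab i 3 by (auto simp: A_def B_def E_def)
      have "(c - p a) \<bullet> (p b - p a) = (c - p i) \<bullet> (p b - p i) - (c - p i) \<bullet> (p a - p i)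
          + ((p a - p i) \<bullet> (p a - p i) - (p b - p i) \<bullet> (p b - p i) + (p b - p a) \<bullet> (p b - p a)) / 2"
        by (simp add: inner_diff_left inner_diff_right inner_commute field_simps)
      also have "\<dots> = d $ (i, b) * B - d $ (i, a) * A + (A\<^sup>2 - B\<^sup>2 + E\<^sup>2) / 2"
        unfolding ci[OF ab(1)] ci[OF ab(2)] sq by (simp add: A_def B_def E_def)
      also have "\<dots> = d $ (a, b) * E"
        unfolding L using tri by (simp add: power2_eq_square field_simps)
      finally show ?thesis by (simp add: E_def)
    qed
  qed
  then have "is_center p \<sigma> d c" unfolding is_center_def by blast
  then show ?thesis by (rule that)
qed

lemma height2_center:
  assumes p: "realizes p {i, j, k, l} (lengths T d)" and card: "card {i, j, k, l} = 4"
    and c: "is_center p {i, j, k, l} d c"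
  shows "height2 T d i j k = (c - p i) \<bullet> perp (p j - p i) (p k - p i) / norm (perp (p j - p i) (p k - p i))"
proof -
  have d: "i \<noteq> j" "i \<noteq> k" using card by (auto simp: card_insert_if split: if_splits)
  have ne: "p j - p i \<noteq> 0" "p k - p i \<noteq> 0" using p d by (auto simp: realizes_def inj_on_def)
  have "d $ (i, j) = (c - p i) \<bullet> (p j - p i) / norm (p j - p i)"
    "d $ (i, k) = (c - p i) \<bullet> (p k - p i) / norm (p k - p i)"
    using c d ne by (auto simp: is_center_def)
  then show ?thesis
    using component_perp_vangle[OF ne perp_edge_nonzero[OF p card], of "c - p i"]
      angle_at_realization[of p i j k "lengths T d"] realizes_subset[OF p, of "{i, j, k}"]
    by (simp add: height2_def Let_def)
qed

lemma height3_center: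
  assumes p: "realizes p {i, j, k, l} (lengths T d)" and card: "card {i, j, k, l} = 4"
    and c: "is_center p {i, j, k, l} d c"
  shows "height3 T d i j k l = (c - p i) \<bullet> height_vector p i j k l / norm (height_vector p i j k l)"
proof -
  have p': "realizes p {i, j, l, k} (lengths T d)" and card': "card {i, j, l, k} = 4"
    and c': "is_center p {i, j, l, k} d c"
    using p card c by (simp_all add: insert_commute)
  show ?thesis
    using component_perp_vangle[OF perp_edge_nonzero[OF p card] perp_edge_nonzero[OF p' card'],
        folded height_vector_def, OF height_vector_nonzero[OF p card], of "c - p i"]
      dihedral_angle_realization[OF p] height2_center[OF p card c] height2_center[OF p' card' c']
    by (simp add: height3_def Let_def)
qed

text \<open>By \<open>height3_center\<close> both sides are the component of the center along the altitude onto the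
  face, which the edges of the face share.\<close>

lemma height3_rotate:
  assumes "realizes p {i, j, k, l} (lengths T d)" "card {i, j, k, l} = 4"
    "is_center p {i, j, k, l} d c"
  shows "height3 T d j k i l = height3 T d i j k l"
proof -
  have p': "realizes p {j, k, i, l} (lengths T d)" and card': "card {j, k, i, l} = 4"
    and c': "is_center p {j, k, i, l} d c"
    using assms by (simp_all add: insert_commute)
  have "(c - p j) \<bullet> height_vector p i j k l = (c - p i) \<bullet> height_vector p i j k l"
    using height_vector_inner(1)[of p i j k l] by (simp add: inner_diff_left inner_diff_right inner_commute)
  then show ?thesis
    unfolding height3_center[OF assms] height3_center[OF p' card' c'] height_vector_rotate[of p j k i l] by simp
qed


section \<open>Conformal motions of a tetrahedron\<close>

text \<open>In the plane of the face, write \<open>Y = \<phi> (p - c)\<close> and let \<open>F\<close> be the affine interpolation of \<open>\<phi>\<close>.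
  The first product on the left is, up to the distance of the center from the face, the tangential
  component of the increment of \<open>Y\<close> along the edge times the normal component of the gradient of \<open>F\<close>;
  the second is the product with tangential and normal components exchanged. Their difference is
  therefore a cross product of the increment of \<open>Y\<close> with the fixed gradient. The right-hand side
  is this cross product in terms of inner products of edge vectors; it adds up to zero around
  the triangle.\<close>

lemma conformal_edge_defect:
  fixes \<phi> :: "'v::finite \<Rightarrow> real"
  assumes p: "realizes p {i, j, k, l} (lengths T d)" and card: "card {i, j, k, l} = 4"
    and c: "is_center p {i, j, k, l} d c"
  defines "V \<equiv> (\<lambda>m. \<phi> m *\<^sub>R (p m - c))"
  defines "gi \<equiv> (p j - p i) \<bullet> (p k - p i)" and "gj \<equiv> (p k - p j) \<bullet> (p i - p j)"
  defines "A \<equiv> (c - p i) \<bullet> (p j - p i)" and "B \<equiv> (c - p i) \<bullet> (p k - p i)"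
  defines "D \<equiv> norm (p j - p i) * norm (perp (p j - p i) (p k - p i))"
  shows "(d $ (i, j) * \<phi> i + d $ (j, i) * \<phi> j) * face_rotation p V i j k l -
      height2 T d i j k * height3 T d i j k l * (\<phi> i - \<phi> j)\<^sup>2 / norm (p j - p i) =
    height3 T d i j k l / D *
      (A * (\<phi> i)\<^sup>2 + (gj - A) * \<phi> i * \<phi> j + gi * (\<phi> j)\<^sup>2 - B * (\<phi> i - \<phi> j)\<^sup>2
        - (A * \<phi> i + (gi + gj - A) * \<phi> j) * \<phi> k)"
proof -
  have d: "i \<noteq> j" "i \<noteq> k" using card by (auto simp: card_insert_if split: if_splits)
  define n where "n = norm (p j - p i)"
  define X where "X = norm (perp (p j - p i) (p k - p i))"
  define w where "w = height_vector p i j k l"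
  define H where "H = height3 T d i j k l"
  have n: "n \<noteq> 0" using p d by (auto simp: realizes_def inj_on_def n_def)
  have X: "X \<noteq> 0" using perp_edge_nonzero[OF p card] by (simp add: X_def)
  have nn: "n\<^sup>2 = gi + gj"
    by (simp add: n_def gi_def gj_def power2_norm_eq_inner inner_diff_left inner_diff_right inner_commute)
  have dd: "d $ (i, j) = A / n" "d $ (j, i) = (gi + gj - A) / n"
  proof -
    show "d $ (i, j) = A / n" using c d n by (auto simp: is_center_def A_def n_def)
    have "gi + gj - A = (c - p j) \<bullet> (p i - p j)"
      unfolding gi_def gj_def A_def
      by (simp add: inner_diff_left inner_diff_right inner_commute)
    then show "d $ (j, i) = (gi + gj - A) / n"
      using c d n by (auto simp: is_center_def n_def norm_minus_commute)
  qed
  have h2: "height2 T d i j k = (B - gi / n\<^sup>2 * A) / X"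
    unfolding height2_center[OF p card c]
    by (simp add: X_def perp_def inner_diff_right A_def B_def gi_def n_def inner_commute 
        power2_norm_eq_inner)
  have \<mu>: "w \<bullet> V m / norm w = - H * \<phi> m" if "m \<in> {i, j, k}" for m
  proof -
    have "w \<bullet> (p m - p i) = 0" using that height_vector_inner[of p i j k l] by (auto simp: w_def)
    then have "w \<bullet> (p m - c) = - ((c - p i) \<bullet> w)"
      by (simp add: inner_diff_left inner_diff_right inner_commute)
    then show ?thesis unfolding H_def height3_center[OF p card c]
      by (simp add: V_def w_def)
  qed
  have rot: "n * face_rotation p V i j k l = - H * ((gi + gj) * \<phi> k - gj * \<phi> i - gi * \<phi> j) / (n * X)"
  proof -
    have m: "w \<bullet> V i / norm w = - H * \<phi> i" "w \<bullet> V j / norm w = - H * \<phi> j" "w \<bullet> V k / norm w = - H * \<phi> k"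
      using \<mu> by blast+
    have "n * face_rotation p V i j k l =
        ((gi + gj) * (- H * \<phi> k) - gj * (- H * \<phi> i) - gi * (- H * \<phi> j)) / (n * X)"
      using face_rotation_cycle(1)[OF p card, of V]
      unfolding gi_def[symmetric] gj_def[symmetric] n_def[symmetric] X_def[symmetric] w_def[symmetric] m .
    also have "(gi + gj) * (- H * \<phi> k) - gj * (- H * \<phi> i) - gi * (- H * \<phi> j) =
        - H * ((gi + gj) * \<phi> k - gj * \<phi> i - gi * \<phi> j)" by (simp add: algebra_simps)
    finally show ?thesis .
  qed
  have frot: "face_rotation p V i j k l = - H * ((gi + gj) * \<phi> k - gj * \<phi> i - gi * \<phi> j) / (n\<^sup>2 * X)"
  proof -
    have "face_rotation p V i j k l = n * face_rotation p V i j k l / n" using n by simp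
    also have "\<dots> = - H * ((gi + gj) * \<phi> k - gj * \<phi> i - gi * \<phi> j) / (n\<^sup>2 * X)"
      unfolding rot by (simp add: power2_eq_square mult_ac)
    finally show ?thesis .
  qed
  define S where "S = gi + gj"
  define L where "L = A * \<phi> i + (S - A) * \<phi> j"
  define N where "N = S * \<phi> k - gj * \<phi> i - gi * \<phi> j"
  define q where "q = (\<phi> i - \<phi> j)\<^sup>2"
  have S: "S \<noteq> 0" "n\<^sup>2 = S" using n by (simp_all add: S_def flip: nn)
  have "(A / n * \<phi> i + (S - A) / n * \<phi> j) * (- H * N / (S * X)) - (B - gi / S * A) / X * H * q / n =
      H / (n * X) * (gi / S * A * q - L * N / S - B * q)"
    by (simp add: L_def divide_inverse algebra_simps)
  \<comment> \<open>The squared edge length \<open>S\<close> cancels, because \<open>S = gi + gj\<close>.\<close>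
  also have "gi / S * A * q - L * N / S = 
      A * (\<phi> i)\<^sup>2 + (gj - A) * \<phi> i * \<phi> j + gi * (\<phi> j)\<^sup>2 - L * \<phi> k"
  proof -
    have "gi * A * q - L * N = S * 
        (A * (\<phi> i)\<^sup>2 + (gj - A) * \<phi> i * \<phi> j + gi * (\<phi> j)\<^sup>2 - L * \<phi> k)"
      unfolding q_def L_def N_def S_def by (simp add: power2_eq_square algebra_simps)
    then show ?thesis using S(1) by (simp add: field_simps)
  qed
  finally show ?thesis
    unfolding frot dd h2 unfolding H_def[symmetric] n_def[symmetric] X_def[symmetric] D_def
      S(2) S_def[symmetric] N_def[symmetric] q_def[symmetric] L_def[symmetric]
    by (simp add: algebra_simps)
qed

text \<open>The increments of \<open>Y\<close> in \<open>conformal_edge_defect\<close> telescope around the triangle.\<close>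

lemma conformal_face_sum:
  fixes \<phi> :: "'v::finite \<Rightarrow> real"
  assumes p: "realizes p {i, j, k, l} (lengths T d)" and card: "card {i, j, k, l} = 4"
    and c: "is_center p {i, j, k, l} d c"
  defines "V \<equiv> (\<lambda>m. \<phi> m *\<^sub>R (p m - c))"
  shows "(d $ (i, j) * \<phi> i + d $ (j, i) * \<phi> j) * face_rotation p V i j k l
    + (d $ (j, k) * \<phi> j + d $ (k, j) * \<phi> k) * face_rotation p V j k i l
    + (d $ (k, i) * \<phi> k + d $ (i, k) * \<phi> i) * face_rotation p V k i j l =
    height2 T d i j k * height3 T d i j k l * (\<phi> i - \<phi> j)\<^sup>2 / norm (p j - p i)
    + height2 T d j k i * height3 T d j k i l * (\<phi> j - \<phi> k)\<^sup>2 / norm (p k - p j)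
    + height2 T d k i j * height3 T d k i j l * (\<phi> k - \<phi> i)\<^sup>2 / norm (p i - p k)"
proof -
  have d: "i \<noteq> j" "i \<noteq> k" "j \<noteq> k" using card by (auto simp: card_insert_if split: if_splits)
  have ne: "p i \<noteq> p j" "p j \<noteq> p k" "p k \<noteq> p i"
    using p d by (auto simp: realizes_def inj_on_def)
  have 1: "realizes p {j, k, i, l} (lengths T d)" "card {j, k, i, l} = 4" "is_center p {j, k, i, l} d c"
    and 2: "realizes p {k, i, j, l} (lengths T d)" "card {k, i, j, l} = 4" "is_center p {k, i, j, l} d c"
    using p card c by (simp_all add: insert_commute)
  have H: "height3 T d j k i l = height3 T d i j k l" "height3 T d k i j l = height3 T d i j k l"
    using height3_rotate[OF p card c] height3_rotate[OF 1] by simp_all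
  define gi gj gk where "gi = (p j - p i) \<bullet> (p k - p i)" and "gj = (p k - p j) \<bullet> (p i - p j)"
    and "gk = (p i - p k) \<bullet> (p j - p k)"
  define A B where "A = (c - p i) \<bullet> (p j - p i)" and "B = (c - p i) \<bullet> (p k - p i)"
  define D where "D = norm (p j - p i) * norm (perp (p j - p i) (p k - p i))"
  have D: "norm (p k - p j) * norm (perp (p k - p j) (p i - p j)) = D"
    "norm (p i - p k) * norm (perp (p i - p k) (p j - p k)) = D"
    using triangle_area_rotate[of p i j k] triangle_area_rotate[of p j k i] ne by (simp_all add: D_def)
  \<comment> \<open>The remaining projections of the center are determined by those at \<open>i\<close>, which makes the
    three right-hand sides polynomials in common variables.\<close>
  have C: "(c - p j) \<bullet> (p k - p j) = B - A + gj" "(c - p j) \<bullet> (p i - p j) = gi + gj - A"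
    "(c - p k) \<bullet> (p i - p k) = gi + gk - B" "(c - p k) \<bullet> (p j - p k) = gk - B + A"
    unfolding A_def B_def gi_def gj_def gk_def
    by (simp_all add: inner_diff_left inner_diff_right inner_commute)
  note E = conformal_edge_defect[OF p card c, of \<phi>] conformal_edge_defect[OF 1, of \<phi>]
    conformal_edge_defect[OF 2, of \<phi>]
  note E' = E[folded V_def, folded gi_def gj_def gk_def, folded A_def B_def D_def,
      unfolded D C H]
  define \<kappa> where "\<kappa> = height3 T d i j k l / D"
  define x y z where "x = \<phi> i" and "y = \<phi> j" and "z = \<phi> k"
  have "\<kappa> * (A * x\<^sup>2 + (gj - A) * x * y + gi * y\<^sup>2 - B * (x - y)\<^sup>2 - (A * x + (gi + gj - A) * y) * z)
    + \<kappa> * ((B - A + gj) * y\<^sup>2 + (gk - (B - A + gj)) * y * z + gj * z\<^sup>2 - (gi + gj - A) * (y - z)\<^sup>2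
        - ((B - A + gj) * y + (gj + gk - (B - A + gj)) * z) * x)
    + \<kappa> * ((gi + gk - B) * z\<^sup>2 + (gi - (gi + gk - B)) * z * x + gk * x\<^sup>2 - (gk - B + A) * (z - x)\<^sup>2
        - ((gi + gk - B) * z + (gk + gi - (gi + gk - B)) * x) * y) = 0"
    unfolding distrib_left[symmetric] by (simp add: power2_eq_square algebra_simps)
  then show ?thesis using E' unfolding H \<kappa>_def x_def y_def z_def by argo
qed


section \<open>Sums over the tetrahedra\<close>

text \<open>Summing over orderings of the vertices makes all symmetrizations reindexings.\<close>

definition ordered_tetrahedra :: "'v set set \<Rightarrow> ('v \<times> 'v \<times> 'v \<times> 'v) set" where
  "ordered_tetrahedra T = {(i, j, k, l). {i, j, k, l} \<in> T \<and> card {i, j, k, l} = 4}"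

lemma sum_ordered_tetrahedra_swap:
  "(\<Sum>(i, j, k, l)\<in>ordered_tetrahedra T. F i j l k) = (\<Sum>(i, j, k, l)\<in>ordered_tetrahedra T. F i j k l)"
  by (rule sum.reindex_bij_witness[where i = "\<lambda>(i, j, k, l). (i, j, l, k)"
        and j = "\<lambda>(i, j, k, l). (i, j, l, k)"])
     (auto simp: ordered_tetrahedra_def insert_commute)

lemma sum_ordered_tetrahedra_rotate:
  "(\<Sum>(i, j, k, l)\<in>ordered_tetrahedra T. F j k i l) = (\<Sum>(i, j, k, l)\<in>ordered_tetrahedra T. F i j k l)"
  by (rule sum.reindex_bij_witness[where i = "\<lambda>(i, j, k, l). (k, i, j, l)"
        and j = "\<lambda>(i, j, k, l). (j, k, i, l)"])
     (auto simp: ordered_tetrahedra_def insert_commute)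

lemma sum_directed_edges_swap:
  "(\<Sum>(i, j)\<in>directed_edges T. F j i) = (\<Sum>(i, j)\<in>directed_edges T. F i j)"
  by (rule sum.reindex_bij_witness[where i = "\<lambda>(i, j). (j, i)" and j = "\<lambda>(i, j). (j, i)"])
     (auto simp: directed_edges_def insert_commute)

lemma sum_directed_tetrahedra_sum:
  fixes T :: "'v::finite set set"
  assumes "simplicial_complex_on_UNIV T"
  shows "(\<Sum>(i, j)\<in>directed_edges T. w i j * tetrahedra_sum T i j (F i j)) =
    (\<Sum>(i, j, k, l)\<in>ordered_tetrahedra T. w i j * F i j k l) / 2"
proof -
  define S where "S = (\<lambda>i j. {(k, l). {i, j, k, l} \<in> T \<and> card {i, j, k, l} = 4})"
  have sub: "(i, j) \<in> directed_edges T" if "(k, l) \<in> S i j" for i j k l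
  proof -
    have "{i, j} \<in> T" using that assms by (auto simp: S_def simplicial_complex_on_UNIV_def)
    moreover have "i \<noteq> j" using that by (auto simp: S_def card_insert_if split: if_splits)
    ultimately show ?thesis by (simp add: directed_edges_def)
  qed
  have "(\<Sum>(i, j)\<in>directed_edges T. w i j * tetrahedra_sum T i j (F i j)) =
    (\<Sum>e\<in>directed_edges T. \<Sum>f\<in>S (fst e) (snd e). w (fst e) (snd e) * F (fst e) (snd e) (fst f) (snd f)) / 2"
    by (simp add: tetrahedra_sum_def S_def sum_distrib_left sum_divide_distrib case_prod_unfold)
  also have "(\<Sum>e\<in>directed_edges T. \<Sum>f\<in>S (fst e) (snd e). w (fst e) (snd e) * F (fst e) (snd e) (fst f) (snd f))
    = (\<Sum>(e, f)\<in>(SIGMA e:directed_edges T. S (fst e) (snd e)). w (fst e) (snd e) * F (fst e) (snd e) (fst f) (snd f))"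
    by (subst sum.Sigma) auto
  also have "\<dots> = (\<Sum>(i, j, k, l)\<in>ordered_tetrahedra T. w i j * F i j k l)"
    by (rule sum.reindex_bij_witness[where i = "\<lambda>(i, j, k, l). ((i, j), (k, l))"
        and j = "\<lambda>((i, j), (k, l)). (i, j, k, l)"])
       (auto simp: ordered_tetrahedra_def S_def intro: sub[unfolded S_def])
  finally show ?thesis .
qed

text \<open>An ordering \<open>(i, j, k, l)\<close> stands for the face \<open>{i, j, k}\<close> of a tetrahedron with a chosen edge
  \<open>{i, j}\<close>. Rotating the first three vertices runs through the edges of the face, so an identity for
  each face may be summed. The factor \<open>2\<close> counts the two faces at each edge.\<close>

lemma sum_face_rotations:
  assumes "\<And>i j k l. (i, j, k, l) \<in> ordered_tetrahedra T \<Longrightarrow>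
    w i j * R i j k l + w j k * R j k i l + w k i * R k i j l =
    G i j k l + G j k i l + (G k i j l :: real)"
  shows "(\<Sum>(i, j, k, l)\<in>ordered_tetrahedra T. w i j * (R i j k l + R i j l k)) =
    2 * (\<Sum>(i, j, k, l)\<in>ordered_tetrahedra T. G i j k l)"
proof -
  let ?Q = "ordered_tetrahedra T"
  have cyc: "3 * (\<Sum>(i, j, k, l)\<in>?Q. F i j k l) = 
      (\<Sum>(i, j, k, l)\<in>?Q. F i j k l + F j k i l + F k i j l)" for F :: "_ \<Rightarrow> _ \<Rightarrow> _ \<Rightarrow> _ \<Rightarrow> real"
    using sum_ordered_tetrahedra_rotate[of F T] sum_ordered_tetrahedra_rotate[of "\<lambda>i j k l. F j k i l" T]
    by (simp add: sum.distrib case_prod_unfold)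
  have "(\<Sum>(i, j, k, l)\<in>?Q. w i j * (R i j k l + R i j l k)) =
      (\<Sum>(i, j, k, l)\<in>?Q. w i j * R i j k l) + (\<Sum>(i, j, k, l)\<in>?Q. w i j * R i j l k)"
    by (simp add: sum.distrib case_prod_unfold distrib_left)
  also have "\<dots> = 2 * (\<Sum>(i, j, k, l)\<in>?Q. w i j * R i j k l)"
    using sum_ordered_tetrahedra_swap[of "\<lambda>i j k l. w i j * R i j k l" T] by simp
  also have "3 * (\<Sum>(i, j, k, l)\<in>?Q. w i j * R i j k l) = 3 * (\<Sum>(i, j, k, l)\<in>?Q. G i j k l)"
    unfolding cyc by (rule sum.cong) (use assms in auto)
  then have "(\<Sum>(i, j, k, l)\<in>?Q. w i j * R i j k l) = (\<Sum>(i, j, k, l)\<in>?Q. G i j k l)"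
    by simp
  finally show ?thesis .
qed


section \<open>Variation of the angle deficits\<close>

text \<open>Every variation of the squared lengths of one simplex is induced by a motion of its vertices:
  keep a vertex \<open>i\<close> fixed and let the velocity of \<open>a\<close> have as inner products with the edge vectors
  at \<open>i\<close> half the variation of the Gram matrix.\<close>

lemma realizes_velocities:
  assumes p: "realizes p \<sigma> len" and "\<sigma> \<noteq> {}"
  obtains V where "\<And>a b. a \<in> \<sigma> \<Longrightarrow> b \<in> \<sigma> \<Longrightarrow> a \<noteq> b \<Longrightarrow> (p a - p b) \<bullet> (V a - V b) = L {a, b}"
proof -
  obtain i where i: "i \<in> \<sigma>" using assms by auto
  define M where "M = (\<lambda>a b. if a = b then 0 else L {a, b})"
  have M: "M a b = M b a" for a b by (simp add: M_def insert_commute)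
  have "\<exists>v. \<forall>b\<in>\<sigma> - {i}. v \<bullet> (p b - p i) = (M i a + M i b - M a b) / 2" for a
    using realizes_prescribed_inner[OF p i, of "\<lambda>b. (M i a + M i b - M a b) / 2"] by metis
  then obtain V0 where V0: "V0 a \<bullet> (p b - p i) = (M i a + M i b - M a b) / 2" if "b \<in> \<sigma> - {i}" for a b
    by metis
  define V where "V = (\<lambda>a. if a = i then 0 else V0 a)"
  have V: "V a \<bullet> (p b - p i) = (M i a + M i b - M a b) / 2" if "b \<in> \<sigma>" for a b
    using V0[of b a] that M[of a i] by (cases "b = i"; cases "a = i") (auto simp: V_def M_def)
  show ?thesis
  proof
    fix a b assume ab: "a \<in> \<sigma>" "b \<in> \<sigma>" "a \<noteq> b"
    have "(p a - p b) \<bullet> (V a - V b) = V a \<bullet> (p a - p i) - V a \<bullet> (p b - p i) - V b \<bullet> (p a - p i) + V b \<bullet> (p b - p i)"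
      by (simp add: inner_diff_left inner_diff_right inner_commute)
    also have "\<dots> = M a b"
      unfolding V[OF ab(1)] V[OF ab(2)] using M[of b a] by (simp add: M_def field_simps)
    finally show "(p a - p b) \<bullet> (V a - V b) = L {a, b}" using ab by (simp add: M_def)
  qed
qed

lemma angle_deficit_commute: "angle_deficit T len j i = angle_deficit T len i j"
  by (simp add: angle_deficit_def tetrahedra_sum_def insert_commute
      dihedral_angle_commute(1)[of len j i])

lemma angle_deficit_has_derivative:
  fixes len :: "'b::real_normed_vector \<Rightarrow> real ^ ('v::finite set)"
  assumes der: "(len has_derivative len') (at x)"
    and ev: "\<forall>\<^sub>F y in nhds x. piecewise_flat T (len y)"
    and P: "\<And>\<sigma>. \<sigma> \<in> T \<Longrightarrow> realizes (P \<sigma>) \<sigma> (len x)"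
    and V: "\<And>\<sigma> h a b. \<sigma> \<in> T \<Longrightarrow> a \<in> \<sigma> \<Longrightarrow> b \<in> \<sigma> \<Longrightarrow> a \<noteq> b \<Longrightarrow>
      (P \<sigma> a - P \<sigma> b) \<bullet> (V \<sigma> h a - V \<sigma> h b) = len x $ {a, b} * len' h $ {a, b}"
  defines "R \<equiv> (\<lambda>h i j k l. face_rotation (P {i, j, k, l}) (V {i, j, k, l} h) i j k l)"
  shows "((\<lambda>y. angle_deficit T (len y) i j) has_derivative
    (\<lambda>h. tetrahedra_sum T i j (\<lambda>k l. R h i j k l + R h i j l k))) (at x)"
proof -
  have dih: "((\<lambda>y. dihedral_angle (len y) i j k l) has_derivative (\<lambda>h. - (R h i j k l + R h i j l k))) (at x)"
    if "{i, j, k, l} \<in> T" "card {i, j, k, l} = 4" for k l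
  proof -
    have [simp]: "{i, j, l, k} = {i, j, k, l}" by auto
    show ?thesis
      unfolding R_def \<open>{i, j, l, k} = {i, j, k, l}\<close>
      by (rule dihedral_angle_has_derivative[OF der _ that(2) P[OF that(1)], OF _ V[OF that(1)]])
        (use ev that(1) in \<open>auto elim!: eventually_mono simp: piecewise_flat_def\<close>)
  qed
  show ?thesis
    unfolding angle_deficit_def tetrahedra_sum_def case_prod_unfold
    by (rule has_derivative_eq_rhs[OF has_derivative_diff[OF has_derivative_const
          bounded_linear.has_derivative[OF bounded_linear_divide has_derivative_sum[OF dih]]]])
      (auto simp only: sum_negf mem_Collect_eq case_prod_unfold diff_0 minus_divide_left minus_minus)
qed

text \<open>The Schlaefli formula, summed over the whole triangulation.\<close>

lemma angle_deficit_variation: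
  fixes len :: "'b::real_normed_vector \<Rightarrow> real ^ ('v::finite set)"
  assumes T: "simplicial_complex_on_UNIV T"
    and der: "(len has_derivative len') (at x)"
    and ev: "\<forall>\<^sub>F y in nhds x. piecewise_flat T (len y)"
  obtains D where "\<And>i j. ((\<lambda>y. angle_deficit T (len y) i j) has_derivative D i j) (at x)"
    and "\<And>h. (\<Sum>(i, j)\<in>directed_edges T. len x $ {i, j} * D i j h) = 0"
proof -
  have "piecewise_flat T (len x)" using ev by (rule eventually_nhds_x_imp_x)
  then obtain P where P: "\<And>\<sigma>. \<sigma> \<in> T \<Longrightarrow> realizes (P \<sigma>) \<sigma> (len x)"
    unfolding piecewise_flat_def by metis
  have "\<exists>V. \<forall>a\<in>\<sigma>. \<forall>b\<in>\<sigma>. a \<noteq> b \<longrightarrow> (P \<sigma> a - P \<sigma> b) \<bullet> (V a - V b) = len x $ {a, b} * len' h $ {a, b}"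
    if "\<sigma> \<in> T" for \<sigma> h
    using realizes_velocities[OF P[OF that], of "\<lambda>e. len x $ e * len' h $ e"] T that
    unfolding simplicial_complex_on_UNIV_def by metis
  then obtain V where V: "\<And>\<sigma> h a b. \<sigma> \<in> T \<Longrightarrow> a \<in> \<sigma> \<Longrightarrow> b \<in> \<sigma> \<Longrightarrow> a \<noteq> b \<Longrightarrow>
      (P \<sigma> a - P \<sigma> b) \<bullet> (V \<sigma> h a - V \<sigma> h b) = len x $ {a, b} * len' h $ {a, b}"
    by metis
  define R where "R = (\<lambda>h i j k l. face_rotation (P {i, j, k, l}) (V {i, j, k, l} h) i j k l)"
  define D where "D = (\<lambda>i j h. tetrahedra_sum T i j (\<lambda>k l. R h i j k l + R h i j l k))"
  show ?thesis
  proof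
    show "((\<lambda>y. angle_deficit T (len y) i j) has_derivative D i j) (at x)" for i j
      using angle_deficit_has_derivative[OF der ev P V] by (simp add: D_def R_def)
    fix h
    have "len x $ {i, j} * R h i j k l + len x $ {j, k} * R h j k i l + len x $ {k, i} * R h k i j l = 0"
      if q: "(i, j, k, l) \<in> ordered_tetrahedra T" for i j k l
    proof -
      have s: "{i, j, k, l} \<in> T" "card {i, j, k, l} = 4" using q by (auto simp: ordered_tetrahedra_def)
      then have d: "i \<noteq> j" "i \<noteq> k" "j \<noteq> k" by (auto simp: card_insert_if split: if_splits)
      have e: "{j, k, i, l} = {i, j, k, l}" "{k, i, j, l} = {i, j, k, l}" by auto
      show ?thesis unfolding R_def e
        using face_rotation_schlaefli[OF P[OF s(1)] s(2), of "V {i, j, k, l} h"]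
          realizes_dist(1)[OF P[OF s(1)], of j i] realizes_dist(1)[OF P[OF s(1)], of k j]
          realizes_dist(1)[OF P[OF s(1)], of i k] d by (simp add: insert_commute)
    qed
    then have "(\<Sum>(i, j, k, l)\<in>ordered_tetrahedra T. len x $ {i, j} * (R h i j k l + R h i j l k)) = 
        2 * (\<Sum>(i, j, k, l)\<in>ordered_tetrahedra T. 0)"
      by (intro sum_face_rotations) simp
    then show "(\<Sum>(i, j)\<in>directed_edges T. len x $ {i, j} * D i j h) = 0"
      unfolding D_def by (subst sum_directed_tetrahedra_sum[OF T]) simp
  qed
qed

text \<open>The variation of the angles drops out by the Schlaefli formula.\<close>

lemma EHR_has_derivative:
  fixes len :: "'b::real_normed_vector \<Rightarrow> real ^ ('v::finite set)"
  assumes T: "simplicial_complex_on_UNIV T"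
    and der: "(len has_derivative len') (at x)"
    and ev: "\<forall>\<^sub>F y in nhds x. piecewise_flat T (len y)"
  shows "((\<lambda>y. EHR T (len y)) has_derivative
    (\<lambda>h. (\<Sum>(i, j)\<in>directed_edges T. angle_deficit T (len x) i j * len' h $ {i, j}) / 2)) (at x)"
proof -
  obtain D where D: "\<And>i j. ((\<lambda>y. angle_deficit T (len y) i j) has_derivative D i j) (at x)"
    and D0: "\<And>h. (\<Sum>(i, j)\<in>directed_edges T. len x $ {i, j} * D i j h) = 0"
    using angle_deficit_variation[OF assms] by blast
  have "((\<lambda>y. EHR T (len y)) has_derivative (\<lambda>h. (\<Sum>e\<in>directed_edges T. 
      angle_deficit T (len x) (fst e) (snd e) * len' h $ {fst e, snd e} + 
      D (fst e) (snd e) h * len x $ {fst e, snd e}) / 2)) (at x)"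
    unfolding EHR_def edge_curvature_def case_prod_unfold
    by (intro bounded_linear.has_derivative[OF bounded_linear_divide] has_derivative_sum 
        has_derivative_mult D bounded_linear.has_derivative[OF bounded_linear_vec_nth der])
  then show ?thesis
    by (rule has_derivative_eq_rhs)
      (use D0 in \<open>simp add: fun_eq_iff sum.distrib case_prod_unfold mult.commute\<close>)
qed

text \<open>A conformal variation moves every vertex radially away from the center of each tetrahedron, at
  rate \<open>\<phi>\<close>. Deficits do not depend on the direction of an edge, so on the left \<open>d $ (i, j) * \<phi> h i\<close>
  may be replaced by half the variation of the length, to which \<open>conformal_face_sum\<close> applies.\<close>

lemma conformal_angle_deficit_variation:
  fixes len :: "'b::real_normed_vector \<Rightarrow> real ^ ('v::finite set)"
  assumes T: "simplicial_complex_on_UNIV T"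
    and der: "(len has_derivative len') (at x)"
    and ev: "\<forall>\<^sub>F y in nhds x. piecewise_flat T (len y)"
    and d: "d \<in> metrics T" "len x = lengths T d"
    and conf: "\<And>h i j. (i, j) \<in> directed_edges T \<Longrightarrow>
      len' h $ {i, j} = d $ (i, j) * \<phi> h i + d $ (j, i) * \<phi> h j"
  obtains D where "\<And>i j. ((\<lambda>y. angle_deficit T (len y) i j) has_derivative D i j) (at x)"
    and "\<And>h. (\<Sum>(i, j)\<in>directed_edges T. D i j h * d $ (i, j) * \<phi> h i) =
      (\<Sum>(i, j)\<in>directed_edges T. dual_length T d i j / len x $ {i, j} * (\<phi> h j - \<phi> h i)\<^sup>2)"
proof -
  have "piecewise_flat T (len x)" using ev by (rule eventually_nhds_x_imp_x)
  then obtain P where P: "\<And>\<sigma>. \<sigma> \<in> T \<Longrightarrow> realizes (P \<sigma>) \<sigma> (len x)"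
    unfolding piecewise_flat_def by metis
  have "\<exists>c. is_center (P \<sigma>) \<sigma> d c" if "\<sigma> \<in> T" for \<sigma>
    using is_center_exists[OF d(1) T that P[OF that, unfolded d(2)]] by blast
  then obtain c where c: "\<And>\<sigma>. \<sigma> \<in> T \<Longrightarrow> is_center (P \<sigma>) \<sigma> d (c \<sigma>)" by metis
  define V where "V = (\<lambda>\<sigma> h m. \<phi> h m *\<^sub>R (P \<sigma> m - c \<sigma>))"
  have edge: "(a, b) \<in> directed_edges T" if "\<sigma> \<in> T" "a \<in> \<sigma>" "b \<in> \<sigma>" "a \<noteq> b" for \<sigma> a b
  proof -
    have "{a, b} \<noteq> {}" "{a, b} \<subseteq> \<sigma>" using that by auto
    then have "{a, b} \<in> T" using T \<open>\<sigma> \<in> T\<close> by (simp add: simplicial_complex_on_UNIV_def)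
    then show ?thesis using that by (simp add: directed_edges_def)
  qed
  have V: "(P \<sigma> a - P \<sigma> b) \<bullet> (V \<sigma> h a - V \<sigma> h b) = len x $ {a, b} * len' h $ {a, b}"
    if \<sigma>: "\<sigma> \<in> T" and ab: "a \<in> \<sigma>" "b \<in> \<sigma>" "a \<noteq> b" for \<sigma> h a b
  proof -
    have "(P \<sigma> a - P \<sigma> b) \<bullet> (V \<sigma> h a - V \<sigma> h b) =
        \<phi> h a * ((c \<sigma> - P \<sigma> a) \<bullet> (P \<sigma> b - P \<sigma> a)) + \<phi> h b * ((c \<sigma> - P \<sigma> b) \<bullet> (P \<sigma> a - P \<sigma> b))"
      by (simp add: V_def inner_diff_left inner_diff_right inner_commute algebra_simps)
    also have "\<dots> = len x $ {a, b} * (d $ (a, b) * \<phi> h a + d $ (b, a) * \<phi> h b)"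
      using c[OF \<sigma>] ab realizes_dist(1)[OF P[OF \<sigma>] ab] 
      by (simp add: is_center_def norm_minus_commute algebra_simps)
    finally show ?thesis using conf[OF edge[OF \<sigma> ab]] by simp
  qed
  define R where "R = (\<lambda>h i j k l. face_rotation (P {i, j, k, l}) (V {i, j, k, l} h) i j k l)"
  define D where "D = (\<lambda>i j h. tetrahedra_sum T i j (\<lambda>k l. R h i j k l + R h i j l k))"
  have D: "((\<lambda>y. angle_deficit T (len y) i j) has_derivative D i j) (at x)" for i j
    using angle_deficit_has_derivative[OF der ev P V] by (simp add: D_def R_def)
  \<comment> \<open>Both are derivatives of the same deficit.\<close>
  have D_sym: "D j i = D i j" for i j
    using has_derivative_unique[OF D[of j i]] D[of i j]
    unfolding angle_deficit_commute[of T _ j i] by blast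
  show ?thesis
  proof
    show "((\<lambda>y. angle_deficit T (len y) i j) has_derivative D i j) (at x)" for i j by (rule D)
    fix h
    define \<Delta> where "\<Delta> = (\<lambda>i j. (\<phi> h j - \<phi> h i)\<^sup>2 / len x $ {i, j})"
    define G where "G = (\<lambda>i j k l. \<Delta> i j * (height2 T d i j k * height3 T d i j k l))"
    let ?Q = "ordered_tetrahedra T"
    have cyc: "len' h $ {i, j} * R h i j k l + len' h $ {j, k} * R h j k i l + len' h $ {k, i} * R h k i j l
        = G i j k l + G j k i l + G k i j l"
      if q: "(i, j, k, l) \<in> ?Q" for i j k l
    proof -
      have s: "{i, j, k, l} \<in> T" "card {i, j, k, l} = 4" using q by (auto simp: ordered_tetrahedra_def)
      then have d': "i \<noteq> j" "i \<noteq> k" "j \<noteq> k" by (auto simp: card_insert_if split: if_splits)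
      have e: "{j, k, i, l} = {i, j, k, l}" "{k, i, j, l} = {i, j, k, l}" by auto
      have E: "(i, j) \<in> directed_edges T" "(j, k) \<in> directed_edges T" "(k, i) \<in> directed_edges T"
        using edge[OF s(1)] d' by auto
      note S = conformal_face_sum[OF P[OF s(1), unfolded d(2)] s(2) c[OF s(1)], of "\<phi> h"]
      show ?thesis unfolding R_def e V_def conf[OF E(1)] conf[OF E(2)] conf[OF E(3)] S
        using realizes_dist(1)[OF P[OF s(1)], of j i] realizes_dist(1)[OF P[OF s(1)], of k j]
          realizes_dist(1)[OF P[OF s(1)], of i k] d'
        by (simp add: G_def \<Delta>_def insert_commute power2_commute mult.commute)
    qed
    have "2 * (\<Sum>(i, j)\<in>directed_edges T. D i j h * d $ (i, j) * \<phi> h i) =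
        (\<Sum>(i, j)\<in>directed_edges T. D i j h * d $ (i, j) * \<phi> h i) +
        (\<Sum>(i, j)\<in>directed_edges T. D j i h * d $ (j, i) * \<phi> h j)"
      using sum_directed_edges_swap[of "\<lambda>i j. D i j h * d $ (i, j) * \<phi> h i" T] by simp
    also have "\<dots> = (\<Sum>(i, j)\<in>directed_edges T. len' h $ {i, j} * D i j h)"
      unfolding sum.distrib[symmetric] case_prod_unfold
      by (rule sum.cong) (auto simp: conf D_sym algebra_simps)
    also have "\<dots> = (\<Sum>(i, j, k, l)\<in>?Q. len' h $ {i, j} * (R h i j k l + R h i j l k)) / 2"
      unfolding D_def by (rule sum_directed_tetrahedra_sum[OF T])
    also have "\<dots> = (\<Sum>(i, j, k, l)\<in>?Q. G i j k l)"
      using sum_face_rotations[of T "\<lambda>i j. len' h $ {i, j}", OF cyc] by simp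
    also have "\<dots> = ((\<Sum>(i, j, k, l)\<in>?Q. G i j k l) + (\<Sum>(i, j, k, l)\<in>?Q. G i j l k)) / 2"
      unfolding sum_ordered_tetrahedra_swap[of G] by simp
    also have "\<dots> = (\<Sum>(i, j, k, l)\<in>?Q. \<Delta> i j * dual_area T d i j k l)"
      unfolding sum.distrib[symmetric] case_prod_unfold sum_divide_distrib
      by (rule sum.cong) (auto simp: G_def dual_area_def algebra_simps)
    also have "\<dots> = 2 * (\<Sum>(i, j)\<in>directed_edges T. \<Delta> i j * dual_length T d i j)"
      unfolding dual_length_def sum_directed_tetrahedra_sum[OF T] by simp
    finally show "(\<Sum>(i, j)\<in>directed_edges T. D i j h * d $ (i, j) * \<phi> h i) =
      (\<Sum>(i, j)\<in>directed_edges T. dual_length T d i j / len x $ {i, j} * (\<phi> h j - \<phi> h i)\<^sup>2)"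
      by (simp add: \<Delta>_def mult.commute)
  qed
qed


section \<open>Nearby lengths are realizable\<close>

definition pos_def_on :: "'i set \<Rightarrow> ('i \<Rightarrow> 'i \<Rightarrow> real) \<Rightarrow> bool" where
  "pos_def_on I G \<longleftrightarrow>
     (\<forall>x. (\<exists>a\<in>I. x a \<noteq> 0) \<longrightarrow> 0 < (\<Sum>a\<in>I. \<Sum>b\<in>I. x a * x b * G a b))"

lemma inner_combinations:
  "(\<Sum>a\<in>I. x a *\<^sub>R v a) \<bullet> (\<Sum>b\<in>I. x b *\<^sub>R v b) = (\<Sum>a\<in>I. \<Sum>b\<in>I. x a * x b * (v a \<bullet> v b))"
  unfolding inner_sum_left inner_sum_right by (intro sum.cong refl) (simp add: inner_commute)

lemma pos_def_gram_independent:
  fixes v :: "'i \<Rightarrow> 'a::real_inner"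
  assumes "finite I" and pd: "pos_def_on I G" and G: "\<And>a b. a \<in> I \<Longrightarrow> b \<in> I \<Longrightarrow> v a \<bullet> v b = G a b"
  shows "inj_on v I" "independent (v ` I)"
proof -
  have 0: "x a = 0" if "(\<Sum>a\<in>I. x a *\<^sub>R v a) = 0" "a \<in> I" for x a
  proof (rule ccontr)
    assume "x a \<noteq> 0"
    then have "0 < (\<Sum>a\<in>I. \<Sum>b\<in>I. x a * x b * G a b)" using pd that by (auto simp: pos_def_on_def)
    also have "\<dots> = (\<Sum>a\<in>I. \<Sum>b\<in>I. x a * x b * (v a \<bullet> v b))" using G by simp
    also have "\<dots> = 0" unfolding inner_combinations[symmetric] that(1) by simp
    finally show False by simp
  qed
  show inj: "inj_on v I"
  proof (rule inj_onI, rule ccontr)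
    fix a b assume ab: "a \<in> I" "b \<in> I" "v a = v b" "a \<noteq> b"
    define x where "x = (\<lambda>c. (if c = a then 1 else 0) - (if c = b then 1 else 0 :: real))"
    have "(\<Sum>c\<in>I. x c *\<^sub>R v c) = (\<Sum>c\<in>I. (if c = a then v c else 0)) - (\<Sum>c\<in>I. (if c = b then v c else 0))"
      unfolding sum_subtractf[symmetric] by (rule sum.cong) (auto simp: x_def)
    also have "\<dots> = 0" using ab assms(1) by simp
    finally have "x a = 0" using 0 ab(1) by blast
    then show False using ab by (simp add: x_def)
  qed
  show "independent (v ` I)"
  proof (rule independent_if_scalars_zero)
    show "finite (v ` I)" using assms(1) by simp
    fix f u assume "(\<Sum>u\<in>v ` I. f u *\<^sub>R u) = 0" "u \<in> v ` I"
    then show "f u = 0" using 0[of "f \<circ> v"] by (auto simp: sum.reindex[OF inj])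
  qed
qed

text \<open>Cholesky: a new vector is its prescribed component in the span of the previous ones plus an
  orthogonal vector, whose squared length is positive because the form is.\<close>

lemma gram_realization:
  fixes G :: "'i \<Rightarrow> 'i \<Rightarrow> real"
  assumes "finite I" "card I \<le> DIM('a::euclidean_space)" "pos_def_on I G"
    and sym: "\<And>a b. G a b = G b a"
  shows "\<exists>v :: 'i \<Rightarrow> 'a. \<forall>a\<in>I. \<forall>b\<in>I. v a \<bullet> v b = G a b"
  using assms(1-3)
proof (induction I rule: finite_induct)
  case empty
  then show ?case by simp
next
  case (insert a I)
  have pd: "0 < (\<Sum>c\<in>insert a I. \<Sum>b\<in>insert a I. x c * x b * G c b)" if "\<exists>c\<in>insert a I. x c \<noteq> 0" for x
    using insert.prems(2) that by (auto simp only: pos_def_on_def)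
  have pdI: "pos_def_on I G"
    unfolding pos_def_on_def
  proof (intro allI impI)
    fix x :: "'i \<Rightarrow> real" assume "\<exists>c\<in>I. x c \<noteq> 0"
    then have "\<exists>c\<in>insert a I. (if c = a then 0 else x c) \<noteq> 0" using insert.hyps by auto
    note pd[OF this]
    also have "(\<Sum>c\<in>insert a I. \<Sum>b\<in>insert a I.
        (if c = a then 0 else x c) * (if b = a then 0 else x b) * G c b) =
      (\<Sum>c\<in>I. \<Sum>b\<in>I. (if c = a then 0 else x c) * (if b = a then 0 else x b) * G c b)"
      using insert.hyps by simp
    also have "\<dots> = (\<Sum>c\<in>I. \<Sum>b\<in>I. x c * x b * G c b)"
      using insert.hyps by (intro sum.cong refl) auto
    finally show "0 < (\<Sum>c\<in>I. \<Sum>b\<in>I. x c * x b * G c b)" .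
  qed
  then obtain v :: "'i \<Rightarrow> 'a" where v: "\<And>b c. b \<in> I \<Longrightarrow> c \<in> I \<Longrightarrow> v b \<bullet> v c = G b c"
    using insert.IH insert.prems insert.hyps by auto
  note ind = pos_def_gram_independent[OF insert.hyps(1) pdI v]
  obtain w where w: "w \<in> span (v ` I)" "\<And>u. u \<in> v ` I \<Longrightarrow> w \<bullet> u = G a (the_inv_into I v u)"
    using independent_prescribed_inner[OF ind(2), of "\<lambda>u. G a (the_inv_into I v u)"] by blast
  have wv: "w \<bullet> v b = G a b" if "b \<in> I" for b
    using w(2)[of "v b"] that by (simp add: the_inv_into_f_f[OF ind(1)])
  obtain y where y: "w = (\<Sum>b\<in>I. y b *\<^sub>R v b)"
  proof -
    obtain u where "w = (\<Sum>z\<in>v ` I. u z *\<^sub>R z)"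
      using w(1) insert.hyps(1) by (auto simp: span_finite)
    then show ?thesis using that[of "u \<circ> v"] by (simp add: sum.reindex[OF ind(1)])
  qed
  have ww: "w \<bullet> w = (\<Sum>b\<in>I. y b * G a b)"
  proof -
    have "w \<bullet> w = w \<bullet> (\<Sum>b\<in>I. y b *\<^sub>R v b)" using y by simp
    then show ?thesis by (simp add: inner_sum_right wv)
  qed
  have pos: "0 < G a a - w \<bullet> w"
  proof -
    \<comment> \<open>The form at the coefficients of \<open>v a - w\<close>, with \<open>v a\<close> the vector sought.\<close>
    define x where "x = (\<lambda>c. if c = a then 1 else - y c)"
    have xI: "x b = - y b" if "b \<in> I" for b using that insert.hyps by (auto simp: x_def)
    have "0 < (\<Sum>c\<in>insert a I. \<Sum>b\<in>insert a I. x c * x b * G c b)"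
      by (rule pd) (simp add: x_def)
    also have "\<dots> = G a a + (\<Sum>b\<in>I. x b * G a b) + (\<Sum>c\<in>I. x c * G c a) + (\<Sum>c\<in>I. \<Sum>b\<in>I. x c * x b * G c b)"
      using insert.hyps by (simp add: sum.distrib x_def)
    also have "(\<Sum>c\<in>I. x c * G c a) = (\<Sum>b\<in>I. x b * G a b)" using sym by simp
    also have "(\<Sum>b\<in>I. x b * G a b) = - (w \<bullet> w)" unfolding ww by (simp add: xI sum_negf)
    also have "(\<Sum>c\<in>I. \<Sum>b\<in>I. x c * x b * G c b) = w \<bullet> w"
    proof -
      have "w \<bullet> w = (\<Sum>c\<in>I. \<Sum>b\<in>I. y c * y b * (v c \<bullet> v b))"
        unfolding inner_combinations[symmetric] y[symmetric] by (rule refl)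
      then show ?thesis by (simp add: xI v)
    qed
    finally show ?thesis by simp
  qed
  have "dim (v ` I) \<le> card I"
    using dim_le_card[of "v ` I" "v ` I"] card_image_le[OF insert.hyps(1), of v] insert.hyps(1)
    by (meson finite_imageI le_trans span_superset)
  then have "dim (v ` I) < DIM('a)" using insert.prems(1) insert.hyps by simp
  then obtain u where u: "u \<noteq> 0" "\<And>z. z \<in> span (v ` I) \<Longrightarrow> orthogonal u z"
    using orthogonal_to_subspace_exists by blast
  define z where "z = (sqrt (G a a - w \<bullet> w) / norm u) *\<^sub>R u"
  have zz: "z \<bullet> z = G a a - w \<bullet> w"
    using pos u(1) by (simp add: z_def dot_square_norm power2_eq_square)
  have z: "z \<bullet> s = 0" if "s \<in> span (v ` I)" for s
    using u(2)[OF that] by (simp add: z_def orthogonal_def)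
  have zv: "z \<bullet> v b = 0" if "b \<in> I" for b using z[of "v b"] that by (simp add: span_base)
  have "\<forall>b\<in>insert a I. \<forall>c\<in>insert a I. (v(a := w + z)) b \<bullet> (v(a := w + z)) c = G b c"
  proof (intro ballI)
    fix b c assume bc: "b \<in> insert a I" "c \<in> insert a I"
    have "(w + z) \<bullet> (w + z) = G a a"
      using z[OF w(1)] zz by (simp add: inner_add_left inner_add_right inner_commute)
    moreover have "(w + z) \<bullet> v s = G a s" "v s \<bullet> (w + z) = G a s" if "s \<in> I" for s
      using wv[OF that] zv[OF that] by (simp_all add: inner_add_left inner_add_right inner_commute)
    ultimately show "(v(a := w + z)) b \<bullet> (v(a := w + z)) c = G b c"
      using bc v sym insert.hyps by auto
  qed
  then show ?case by blast
qed

lemma realizes_if_pos_def: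
  fixes len :: "real ^ ('v::finite set)"
  assumes i: "i \<in> \<sigma>" and pd: "pos_def_on (\<sigma> - {i}) (edge_inner len i)"
    and pos: "\<And>a b. a \<in> \<sigma> \<Longrightarrow> b \<in> \<sigma> \<Longrightarrow> a \<noteq> b \<Longrightarrow> 0 < len $ {a, b}"
  obtains q where "realizes q \<sigma> len"
proof -
  have sym: "edge_inner len i a b = edge_inner len i b a" for a b
    by (simp add: edge_inner_def insert_commute add.commute)
  have "card (\<sigma> - {i}) \<le> DIM(real ^ 'v)" by (simp add: card_mono)
  then obtain v :: "'v \<Rightarrow> real ^ 'v" where
    v: "\<And>a b. a \<in> \<sigma> - {i} \<Longrightarrow> b \<in> \<sigma> - {i} \<Longrightarrow> v a \<bullet> v b = edge_inner len i a b"
    using gram_realization[OF _ _ pd sym, where 'a = "real ^ 'v"] by auto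
  note ind = pos_def_gram_independent[OF _ pd v, simplified]
  define q where "q = (\<lambda>a. if a = i then 0 else v a)"
  have dq: "dist (q a) (q b) = len $ {a, b}" if ab: "a \<in> \<sigma>" "b \<in> \<sigma>" "a \<noteq> b" for a b
  proof -
    have n: "norm (v a) = len $ {i, a}" if "a \<in> \<sigma>" "a \<noteq> i" for a
      using v[of a a] that pos[of i a] i by (auto simp: norm_eq_sqrt_inner edge_inner_def)
    consider "a = i" | "b = i" "a \<noteq> i" | "a \<noteq> i" "b \<noteq> i" by blast
    then show ?thesis
    proof cases
      case 3
      have "(dist (q a) (q b))\<^sup>2 = v a \<bullet> v a - 2 * (v a \<bullet> v b) + v b \<bullet> v b"
        using 3 by (simp add: q_def dist_norm power2_norm_eq_inner inner_diff_left inner_diff_right inner_commute)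
      also have "\<dots> = (len $ {a, b})\<^sup>2"
        using v[of a a] v[of b b] v[of a b] 3 ab by (simp add: edge_inner_def)
      finally show ?thesis using pos[OF ab] by (simp add: power2_eq_iff_nonneg)
    qed (use n ab in \<open>auto simp: q_def insert_commute\<close>)
  qed
  have inj: "inj_on q \<sigma>"
    by (rule inj_onI, rule ccontr) (use dq pos in force)
  have "(\<lambda>x. - q i + x) ` (q ` \<sigma> - {q i}) = v ` (\<sigma> - {i})"
  proof -
    have "q ` \<sigma> - {q i} = q ` (\<sigma> - {i})" using inj i by (auto simp: inj_on_def)
    then show ?thesis by (simp add: image_image q_def)
  qed
  then have "\<not> affine_dependent (q ` \<sigma>)"
    using affine_dependent_iff_dependent2[of "q i" "q ` \<sigma>"] i ind(2) by auto
  with inj dq have "realizes q \<sigma> len" by (simp add: realizes_def)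
  then show ?thesis by (rule that)
qed

text \<open>The form is the squared norm of an injective linear map, which is bounded below.\<close>

lemma realizes_pos_def_bound:
  assumes p: "realizes p \<sigma> len" and i: "i \<in> \<sigma>"
  shows "\<exists>m>0. \<forall>x :: real ^ ('v::finite). (\<forall>a. a \<notin> \<sigma> - {i} \<longrightarrow> x $ a = 0) \<longrightarrow>
    m * (norm x)\<^sup>2 \<le> (\<Sum>a\<in>\<sigma> - {i}. \<Sum>b\<in>\<sigma> - {i}. x $ a * x $ b * edge_inner len i a b)"
proof -
  define S :: "(real ^ 'v) set" where "S = {x. \<forall>a. a \<notin> \<sigma> - {i} \<longrightarrow> x $ a = 0}"
  define F where "F = (\<lambda>x :: real ^ 'v. \<Sum>a\<in>\<sigma> - {i}. x $ a *\<^sub>R (p a - p i))"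
  have S: "subspace S" by (auto simp: S_def subspace_def)
  have "linear F"
    unfolding F_def by (intro linearI) (simp_all add: scaleR_add_left sum.distrib scaleR_sum_right)
  then have F: "bounded_linear F" by (simp add: linear_conv_bounded_linear)
  have "\<forall>x\<in>S. F x = 0 \<longrightarrow> x = 0"
  proof (intro ballI impI)
    fix x assume "x \<in> S" "F x = 0"
    then have "x $ a = 0" for a
      using realizes_combination_eq_0[OF p i, of "\<lambda>a. x $ a" a] by (cases "a \<in> \<sigma> - {i}") (auto simp: F_def S_def)
    then show "x = 0" by (simp add: vec_eq_iff)
  qed
  then obtain e where e: "e > 0" "\<forall>x\<in>S. norm (F x) \<ge> e * norm x"
    using injective_imp_isometric[OF closed_subspace[OF S] S F] by blast
  show ?thesis
  proof (intro exI[of _ "e\<^sup>2"] conjI allI impI)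
    show "0 < e\<^sup>2" using e by simp
    fix x :: "real ^ 'v" assume "\<forall>a. a \<notin> \<sigma> - {i} \<longrightarrow> x $ a = 0"
    then have "x \<in> S" by (auto simp: S_def)
    then have "(e * norm x)\<^sup>2 \<le> (norm (F x))\<^sup>2" using e by (intro power_mono) auto
    also have "\<dots> = (\<Sum>a\<in>\<sigma> - {i}. \<Sum>b\<in>\<sigma> - {i}. x $ a * x $ b * edge_inner len i a b)"
      unfolding power2_norm_eq_inner F_def inner_combinations
      by (intro sum.cong refl) (use realizes_edge_inner[OF p i] in auto)
    finally show "e\<^sup>2 * (norm x)\<^sup>2 \<le> (\<Sum>a\<in>\<sigma> - {i}. \<Sum>b\<in>\<sigma> - {i}. x $ a * x $ b * edge_inner len i a b)"
      by (simp add: power_mult_distrib)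
  qed
qed

text \<open>A uniform lower bound on the Gram form survives a small change of its coefficients.\<close>

lemma eventually_realizes:
  fixes len :: "'b::topological_space \<Rightarrow> real ^ ('v::finite set)"
  assumes p: "realizes p \<sigma> (len x)" and "\<sigma> \<noteq> {}" and cont: "(len \<longlongrightarrow> len x) (nhds x)"
  shows "\<forall>\<^sub>F y in nhds x. \<exists>q. realizes q \<sigma> (len y)"
proof -
  obtain i where i: "i \<in> \<sigma>" using assms by auto
  define I where "I = \<sigma> - {i}"
  obtain m where m: "0 < m" "\<forall>z :: real ^ 'v. (\<forall>a. a \<notin> I \<longrightarrow> z $ a = 0) \<longrightarrow>
    m * (norm z)\<^sup>2 \<le> (\<Sum>a\<in>I. \<Sum>b\<in>I. z $ a * z $ b * edge_inner (len x) i a b)"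
    using realizes_pos_def_bound[OF p i] unfolding I_def[symmetric] by auto
  \<comment> \<open>Small enough that changing the \<open>(card I)\<^sup>2\<close> coefficients by \<open>\<eta>\<close> does not use up the bound \<open>m\<close>.\<close>
  define \<eta> where "\<eta> = m / (2 * (real (card I))\<^sup>2 + 1)"
  have \<eta>: "\<eta> > 0" using m by (simp add: \<eta>_def add_nonneg_pos)
  have c: "((\<lambda>y. len y $ e) \<longlongrightarrow> len x $ e) (nhds x)" for e
    by (rule tendsto_vec_nth[OF cont])
  have "((\<lambda>y. edge_inner (len y) i a b) \<longlongrightarrow> edge_inner (len x) i a b) (nhds x)" for a b
    unfolding edge_inner_def by (cases "a = b") (auto intro!: tendsto_intros c)
  then have "\<forall>\<^sub>F y in nhds x. dist (edge_inner (len y) i a b) (edge_inner (len x) i a b) < \<eta>" for a b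
    using \<eta> by (rule tendstoD)
  then have "\<forall>\<^sub>F y in nhds x. \<forall>a\<in>UNIV. \<forall>b\<in>UNIV. dist (edge_inner (len y) i a b) (edge_inner (len x) i a b) < \<eta>"
    by (intro eventually_ball_finite ballI finite)
  moreover have "\<forall>\<^sub>F y in nhds x. \<forall>e\<in>{e. 0 < len x $ e}. 0 < len y $ e"
    by (intro eventually_ball_finite ballI finite order_tendstoD(1)[OF c]) auto
  ultimately show ?thesis
  proof eventually_elim
    case (elim y)
    have pos: "0 < len y $ {a, b}" if "a \<in> \<sigma>" "b \<in> \<sigma>" "a \<noteq> b" for a b
      using realizes_dist(2)[OF p that] elim(2) by auto
    have "pos_def_on I (edge_inner (len y) i)"
      unfolding pos_def_on_def
    proof (intro allI impI)
      fix z :: "'v \<Rightarrow> real" assume "\<exists>a\<in>I. z a \<noteq> 0"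
      then obtain a0 where a0: "a0 \<in> I" "z a0 \<noteq> 0" by auto
      define w :: "real ^ 'v" where "w = (\<chi> a. if a \<in> I then z a else 0)"
      have "w $ a0 \<noteq> 0" using a0 by (simp add: w_def)
      then have w: "(norm w)\<^sup>2 > 0" by auto
      have wz: "w $ a = z a" if "a \<in> I" for a using that by (simp add: w_def)
      have bound: "\<bar>w $ a * w $ b * (edge_inner (len y) i a b - edge_inner (len x) i a b)\<bar> \<le> (norm w)\<^sup>2 * \<eta>" for a b
      proof -
        have "\<bar>w $ a * w $ b\<bar> \<le> norm w * norm w"
          unfolding abs_mult by (intro mult_mono component_le_norm_cart) auto
        moreover have "\<bar>edge_inner (len y) i a b - edge_inner (len x) i a b\<bar> \<le> \<eta>"
          using elim(1) by (auto simp: dist_real_def intro: less_imp_le)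
        ultimately show ?thesis unfolding abs_mult[of "w $ a * w $ b"]
          by (auto simp: power2_eq_square intro!: mult_mono)
      qed
      have "m * (norm w)\<^sup>2 \<le> (\<Sum>a\<in>I. \<Sum>b\<in>I. w $ a * w $ b * edge_inner (len x) i a b)"
        by (rule m(2)[rule_format]) (simp add: w_def)
      also have "\<dots> = (\<Sum>a\<in>I. \<Sum>b\<in>I. w $ a * w $ b * edge_inner (len y) i a b) -
        (\<Sum>a\<in>I. \<Sum>b\<in>I. w $ a * w $ b * (edge_inner (len y) i a b - edge_inner (len x) i a b))"
        by (simp add: sum_subtractf[symmetric] algebra_simps)
      also have "\<dots> \<le> (\<Sum>a\<in>I. \<Sum>b\<in>I. w $ a * w $ b * edge_inner (len y) i a b) + (real (card I))\<^sup>2 * ((norm w)\<^sup>2 * \<eta>)"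
      proof -
        have "\<bar>\<Sum>a\<in>I. \<Sum>b\<in>I. w $ a * w $ b * (edge_inner (len y) i a b - edge_inner (len x) i a b)\<bar>
          \<le> (\<Sum>a\<in>I. \<Sum>b\<in>I. (norm w)\<^sup>2 * \<eta>)"
          by (intro order_trans[OF sum_abs] sum_mono bound)
        then show ?thesis by (simp add: power2_eq_square algebra_simps abs_le_iff)
      qed
      finally have "(m - (real (card I))\<^sup>2 * \<eta>) * (norm w)\<^sup>2 \<le>
          (\<Sum>a\<in>I. \<Sum>b\<in>I. w $ a * w $ b * edge_inner (len y) i a b)"
        by (simp add: algebra_simps)
      moreover have "(real (card I))\<^sup>2 * \<eta> < m"
        using m(1) by (simp add: \<eta>_def divide_simps add_nonneg_pos)
      ultimately have "0 < (\<Sum>a\<in>I. \<Sum>b\<in>I. w $ a * w $ b * edge_inner (len y) i a b)"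
        using w by (smt (verit) mult_pos_pos)
      then show "0 < (\<Sum>a\<in>I. \<Sum>b\<in>I. z a * z b * edge_inner (len y) i a b)"
        using wz by simp
    qed
    then show ?case using realizes_if_pos_def[OF i _ pos] unfolding I_def by metis
  qed
qed

lemma eventually_piecewise_flat:
  fixes len :: "'b::topological_space \<Rightarrow> real ^ ('v::finite set)"
  assumes "simplicial_complex_on_UNIV T" "piecewise_flat T (len x)"
    and "(len \<longlongrightarrow> len x) (nhds x)" and "\<And>y. len y \<in> functions_on (edges T)"
  shows "\<forall>\<^sub>F y in nhds x. piecewise_flat T (len y)"
proof -
  have "\<forall>\<^sub>F y in nhds x. \<exists>q. realizes q \<sigma> (len y)" if "\<sigma> \<in> T" for \<sigma>
    using assms that eventually_realizes[of _ \<sigma> len x]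
    by (auto simp: piecewise_flat_def simplicial_complex_on_UNIV_def)
  then have "\<forall>\<^sub>F y in nhds x. \<forall>\<sigma>\<in>T. \<exists>q. realizes q \<sigma> (len y)"
    by (intro eventually_ball_finite) auto
  then show ?thesis using assms(4) by (auto simp: piecewise_flat_def elim!: eventually_mono)
qed

text \<open>The length of every single edge can be varied slightly without leaving the piecewise flat metrics, and
  by the Schlaefli formula the derivative in that direction is the deficit of the edge.\<close>

lemma critical_lengths_imp_flat:
  fixes T :: "'v::finite set set"
  assumes T: "simplicial_complex_on_UNIV T"
    and crit: "critical_point_on (EHR T) {l. piecewise_flat T l} len"
    and e: "(i, j) \<in> directed_edges T"
  shows "angle_deficit T len i j = 0"
proof -
  let ?S = "{l. piecewise_flat T l}"
  define L where "L = (\<lambda>s. len + s *\<^sub>R axis {i, j} (1::real))"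
  have pf: "piecewise_flat T len" and der: "(EHR T has_derivative (\<lambda>_. 0)) (at len within ?S)"
    using crit by (auto simp: critical_point_on_def)
  have ij: "i \<noteq> j" "{i, j} \<in> edges T" using e by (auto simp: directed_edges_def edges_def)
  have "L s \<in> functions_on (edges T)" for s
    using pf ij by (auto simp: piecewise_flat_def functions_on_def L_def axis_def)
  then have ev: "\<forall>\<^sub>F s in nhds 0. piecewise_flat T (L s)"
    by (intro eventually_piecewise_flat[OF T])
      (use pf in \<open>auto simp: L_def intro!: tendsto_eq_intros simp: filterlim_ident\<close>)
  have L: "(L has_derivative (\<lambda>h. h *\<^sub>R axis {i, j} 1)) (at 0)"
    unfolding L_def by (auto intro!: derivative_eq_intros)
  obtain A where A: "open A" "0 \<in> A" "\<And>s. s \<in> A \<Longrightarrow> piecewise_flat T (L s)"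
    using ev unfolding eventually_nhds by blast
  \<comment> \<open>The derivative within the piecewise flat metrics restricts to the line \<open>L\<close>, which stays among
    them near \<open>0\<close>.\<close>
  have "((EHR T \<circ> L) has_derivative ((\<lambda>_. 0) \<circ> (\<lambda>h. h *\<^sub>R (axis {i, j} 1 :: real ^ 'v set)))) (at 0 within A)"
  proof (rule diff_chain_within)
    show "(L has_derivative (\<lambda>h. h *\<^sub>R axis {i, j} 1)) (at 0 within A)"
      using L by (rule has_derivative_at_withinI)
    have "L 0 = len" by (simp add: L_def)
    moreover have "(EHR T has_derivative (\<lambda>_. 0)) (at len within L ` A)"
      by (rule has_derivative_subset[OF der]) (use A in auto)
    ultimately show "(EHR T has_derivative (\<lambda>_. 0)) (at (L 0) within L ` A)" by simp
  qed
  then have 0: "((\<lambda>s. EHR T (L s)) has_derivative (\<lambda>_. 0)) (at 0)"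
    using at_within_open[OF A(2,1)] by (simp add: o_def)
  have "(\<lambda>h::real. (\<Sum>(a, b)\<in>directed_edges T. angle_deficit T (L 0) a b * (h *\<^sub>R axis {i, j} 1) $ {a, b}) / 2) = (\<lambda>_. 0)"
    by (rule has_derivative_unique[OF EHR_has_derivative[OF T L ev] 0])
  from fun_cong[OF this, of 1]
  have "(\<Sum>(a, b)\<in>directed_edges T. angle_deficit T len a b * axis {i, j} 1 $ {a, b}) = 0"
    by (simp add: L_def)
  also have "(\<Sum>(a, b)\<in>directed_edges T. angle_deficit T len a b * axis {i, j} 1 $ {a, b}) =
      (\<Sum>(a, b)\<in>{(i, j), (j, i)}. angle_deficit T len a b)"
    by (rule sum.mono_neutral_cong_right)
       (use e in \<open>auto simp: axis_def directed_edges_def insert_commute doubleton_eq_iff split: if_splits\<close>)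
  also have "\<dots> = 2 * angle_deficit T len i j"
    using ij by (simp add: angle_deficit_commute[of T len j i])
  finally show ?thesis by simp
qed


section \<open>Symmetry of mixed partial derivatives\<close>

text \<open>By the mean value theorem in direction \<open>a\<close>, the second difference is \<open>t\<close> times the increment of
  \<open>F' a\<close> in direction \<open>t b\<close>. It is symmetric in \<open>a\<close> and \<open>b\<close>, whence Young's theorem below.\<close>

lemma second_difference_limit:
  fixes F :: "'a::real_normed_vector \<Rightarrow> real"
  assumes U: "open U" "x \<in> U"
    and F: "\<And>y. y \<in> U \<Longrightarrow> (F has_derivative F' y) (at y)"
    and A: "((\<lambda>y. F' y a) has_derivative A') (at x)"
  shows "((\<lambda>t. (F (x + t *\<^sub>R a + t *\<^sub>R b) - F (x + t *\<^sub>R a) - F (x + t *\<^sub>R b) + F x) / t\<^sup>2)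
    \<longlongrightarrow> A' b) (at_right 0)"
proof (rule tendstoI)
  fix e :: real assume e: "e > 0"
  \<comment> \<open>The summand \<open>1\<close> keeps \<open>M\<close> positive when \<open>a\<close> and \<open>b\<close> vanish.\<close>
  define M where "M = 2 * (norm a + norm b) + 1"
  have M: "M > 0" "norm a + norm b < M" by (simp_all add: M_def add_nonneg_pos)
  obtain r where r: "r > 0" "ball x r \<subseteq> U" using U openE by blast
  obtain \<delta> where \<delta>: "\<delta> > 0" "\<And>y. norm (y - x) < \<delta> \<Longrightarrow>
      \<bar>F' y a - F' x a - A' (y - x)\<bar> \<le> e / (2 * M) * norm (y - x)"
    using A e M unfolding has_derivative_at_alt by (metis divide_pos_pos mult_pos_pos real_norm_def zero_less_numeral)
  have lin: "linear A'" using A by (rule has_derivative_linear)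
  have main: "dist ((F (x + t *\<^sub>R a + t *\<^sub>R b) - F (x + t *\<^sub>R a) - F (x + t *\<^sub>R b) + F x) / t\<^sup>2) (A' b) < e"
    if t: "0 < t" "t < min r \<delta> / M" for t
  proof -
    have tM: "t * M < min r \<delta>" using t M by (simp add: field_simps)
    have small: "norm (s *\<^sub>R a + u *\<^sub>R b) \<le> t * (norm a + norm b)"
      "norm (s *\<^sub>R a + u *\<^sub>R b) < min r \<delta>" if "0 \<le> s" "s \<le> t" "0 \<le> u" "u \<le> t" for s u
    proof -
      have "norm (s *\<^sub>R a + u *\<^sub>R b) \<le> s * norm a + u * norm b"
        using norm_triangle_ineq[of "s *\<^sub>R a" "u *\<^sub>R b"] that by simp
      also have "\<dots> \<le> t * norm a + t * norm b" using that by (intro add_mono mult_right_mono) auto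
      finally show *: "norm (s *\<^sub>R a + u *\<^sub>R b) \<le> t * (norm a + norm b)" by (simp add: distrib_left)
      also have "\<dots> \<le> t * M" using t M by simp
      finally show "norm (s *\<^sub>R a + u *\<^sub>R b) < min r \<delta>" using tM by simp
    qed
    have inU: "x + (s *\<^sub>R a + u *\<^sub>R b) \<in> U" if "0 \<le> s" "s \<le> t" "0 \<le> u" "u \<le> t" for s u
    proof -
      have "x + (s *\<^sub>R a + u *\<^sub>R b) \<in> ball x r" 
        using small(2)[OF that] unfolding mem_ball dist_commute[of x] by (simp add: dist_norm)
      then show ?thesis using r by blast
    qed
    define g where "g = (\<lambda>s. F (x + (s *\<^sub>R a + t *\<^sub>R b)) - F (x + (s *\<^sub>R a + 0 *\<^sub>R b)))"
    have dF: "((\<lambda>s. F (x + (s *\<^sub>R a + u *\<^sub>R b))) has_real_derivative F' (x + (s *\<^sub>R a + u *\<^sub>R b)) a) (at s)"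
      if "0 \<le> s" "s \<le> t" "0 \<le> u" "u \<le> t" for s u
    proof -
      have "((\<lambda>s. x + (s *\<^sub>R a + u *\<^sub>R b)) has_derivative (\<lambda>h. h *\<^sub>R a)) (at s)"
        by (auto intro!: derivative_eq_intros)
      from has_derivative_compose[OF this F[OF inU[OF that]]]
      show ?thesis
        unfolding has_field_derivative_def
        by (rule has_derivative_eq_rhs)
          (auto simp: fun_eq_iff linear_scale[OF has_derivative_linear[OF F[OF inU[OF that]]]])
    qed
    have "\<exists>s>0. s < t \<and> g t - g 0 = (t - 0) * (F' (x + (s *\<^sub>R a + t *\<^sub>R b)) a - F' (x + (s *\<^sub>R a + 0 *\<^sub>R b)) a)"
      unfolding g_def by (rule MVT2[OF t(1)]) (use t in \<open>intro DERIV_diff dF; auto\<close>)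
    then obtain s where s: "0 < s" "s < t"
      "g t - g 0 = t * (F' (x + (s *\<^sub>R a + t *\<^sub>R b)) a - F' (x + (s *\<^sub>R a + 0 *\<^sub>R b)) a)"
      by auto
    define E where "E = (\<lambda>u. F' (x + (s *\<^sub>R a + u *\<^sub>R b)) a - F' x a - A' (s *\<^sub>R a + u *\<^sub>R b))"
    have E: "\<bar>E u\<bar> \<le> e / (2 * M) * (t * (norm a + norm b))" if "0 \<le> u" "u \<le> t" for u
    proof -
      have "\<bar>E u\<bar> \<le> e / (2 * M) * norm (s *\<^sub>R a + u *\<^sub>R b)"
        using \<delta>(2)[of "x + (s *\<^sub>R a + u *\<^sub>R b)"] small(2)[of s u] that s by (simp add: E_def)
      also have "\<dots> \<le> e / (2 * M) * (t * (norm a + norm b))"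
        using small(1)[of s u] that s e M by (intro mult_left_mono) auto
      finally show ?thesis .
    qed
    have A'b: "A' (s *\<^sub>R a + t *\<^sub>R b) - A' (s *\<^sub>R a + 0 *\<^sub>R b) = t * A' b"
      by (simp add: linear_add[OF lin] linear_scale[OF lin])
    have gE: "g t - g 0 = t * (t * A' b + (E t - E 0))"
      unfolding s(3) E_def A'b[symmetric] by simp
    have Fg: "F (x + t *\<^sub>R a + t *\<^sub>R b) - F (x + t *\<^sub>R a) - F (x + t *\<^sub>R b) + F x = g t - g 0"
      by (simp add: g_def add.assoc)
    have "(F (x + t *\<^sub>R a + t *\<^sub>R b) - F (x + t *\<^sub>R a) - F (x + t *\<^sub>R b) + F x) / t\<^sup>2 - A' b = (E t - E 0) / t"
      unfolding Fg gE using t by (simp add: field_simps power2_eq_square)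
    moreover have "\<bar>E t - E 0\<bar> < e * t"
    proof -
      have "\<bar>E t - E 0\<bar> \<le> 2 * (e / (2 * M) * (t * (norm a + norm b)))"
        using E[of t, OF less_imp_le[OF t(1)] order_refl]
          E[of 0, OF order_refl less_imp_le[OF t(1)]] by linarith
      also have "\<dots> = e * t * ((norm a + norm b) / M)" using M by simp
      also have "\<dots> < e * t * 1"
        using e t M by (intro mult_strict_left_mono) auto
      finally show ?thesis by simp
    qed
    ultimately show ?thesis using t by (simp add: dist_real_def abs_div pos_divide_less_eq)
  qed
  show "\<forall>\<^sub>F t in at_right 0.
      dist ((F (x + t *\<^sub>R a + t *\<^sub>R b) - F (x + t *\<^sub>R a) - F (x + t *\<^sub>R b) + F x) / t\<^sup>2) (A' b) < e"
    unfolding eventually_at_right_field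
    using main r \<delta> M by (intro exI[of _ "min r \<delta> / M"]) auto
qed

lemma mixed_derivatives_eq:
  fixes F :: "'a::real_normed_vector \<Rightarrow> real"
  assumes "open U" "x \<in> U" "\<And>y. y \<in> U \<Longrightarrow> (F has_derivative F' y) (at y)"
    and "((\<lambda>y. F' y a) has_derivative A') (at x)" "((\<lambda>y. F' y b) has_derivative B') (at x)"
  shows "A' b = B' a"
proof -
  have "((\<lambda>t. (F (x + t *\<^sub>R b + t *\<^sub>R a) - F (x + t *\<^sub>R b) - F (x + t *\<^sub>R a) + F x) / t\<^sup>2)
    \<longlongrightarrow> B' a) (at_right 0)"
    by (rule second_difference_limit[OF assms(1-3,5)])
  then have "((\<lambda>t. (F (x + t *\<^sub>R a + t *\<^sub>R b) - F (x + t *\<^sub>R a) - F (x + t *\<^sub>R b) + F x) / t\<^sup>2)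
    \<longlongrightarrow> B' a) (at_right 0)"
    by (simp add: algebra_simps)
  then show ?thesis
    using second_difference_limit[OF assms(1-4)] tendsto_unique trivial_limit_at_right_real by blast
qed


section \<open>Conformal structures\<close>

lemma partial_eq:
  assumes "(F has_derivative F') (at x)"
  shows "partial k F x = F' (axis k 1)"
proof -
  have "((\<lambda>s. x + s *\<^sub>R axis k 1) has_derivative (\<lambda>h. h *\<^sub>R axis k 1)) (at 0)"
    by (auto intro!: derivative_eq_intros)
  moreover have "(F has_derivative F') (at (x + 0 *\<^sub>R axis k 1))" using assms by simp
  ultimately have "((\<lambda>s. F (x + s *\<^sub>R axis k 1)) has_derivative (\<lambda>h. F' (h *\<^sub>R axis k 1))) (at 0)"
    by (rule has_derivative_compose)
  then have "((\<lambda>s. F (x + s *\<^sub>R axis k 1)) has_real_derivative F' (axis k 1)) (at 0)"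
    unfolding has_field_derivative_def
    by (rule has_derivative_eq_rhs) (auto simp: linear_scale[OF has_derivative_linear[OF assms]])
  then show ?thesis unfolding partial_def by (rule DERIV_imp_deriv)
qed

lemma bounded_linear_lengths: "bounded_linear (lengths T)"
  unfolding linear_conv_bounded_linear[symmetric]
  by (rule linearI) (simp_all add: lengths_def vec_eq_iff sum.distrib case_prod_unfold sum_distrib_left)

lemma conformal_structure_has_derivative:
  assumes "conformal_structure T U C" "g \<in> U"
  shows "(C has_derivative frechet_derivative C (at g)) (at g)"
proof -
  have "Ck_on (Suc 0) U C" using assms(1) unfolding conformal_structure_def smooth_on_def by blast
  then show ?thesis using assms(2) by (simp add: frechet_derivative_works)
qed

text \<open>The directed lengths \<open>d\<^sub>i\<^sub>j\<close> and \<open>d\<^sub>j\<^sub>i\<close> are the two partial derivatives of \<open>\<ell>\<^sub>i\<^sub>j\<close>, so \<open>q\<close> is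
  symmetric as a mixed derivative of \<open>\<ell>\<^sub>i\<^sub>j\<close>. Differentiating \<open>\<ell>\<^sub>i\<^sub>j = d\<^sub>i\<^sub>j + d\<^sub>j\<^sub>i\<close> by \<open>f\<^sub>i\<close> gives
  \<open>\<partial>\<^sub>i d\<^sub>i\<^sub>j = d\<^sub>i\<^sub>j - q\<close>, and no other variable enters.\<close>

lemma conformal_structure_derivative:
  fixes T :: "'v::finite set set"
  assumes C: "conformal_structure T U C" and g: "g \<in> U" and e: "(i, j) \<in> directed_edges T"
  defines "q \<equiv> partial j (\<lambda>g. C g $ (i, j)) g"
  defines "C' \<equiv> frechet_derivative C (at g)"
  shows conformal_q_commute: "q = partial i (\<lambda>g. C g $ (j, i)) g"
    and conformal_metric_derivative: "C' h $ (i, j) = C g $ (i, j) * h $ i + q * (h $ j - h $ i)"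
    and conformal_lengths_derivative:
      "lengths T (C' h) $ {i, j} = C g $ (i, j) * h $ i + C g $ (j, i) * h $ j"
proof -
  have e': "(j, i) \<in> directed_edges T" and ij: "i \<noteq> j" using e by (auto simp: directed_edges_def insert_commute)
  have U: "open U" using C by (simp add: conformal_structure_def)
  have dC: "((\<lambda>g. C g $ s) has_derivative (\<lambda>h. frechet_derivative C (at y) h $ s)) (at y)" if "y \<in> U" for y s
    by (rule bounded_linear.has_derivative[OF bounded_linear_vec_nth conformal_structure_has_derivative[OF C that]])
  have dl: "((\<lambda>g. lengths T (C g) $ s) has_derivative (\<lambda>h. lengths T (frechet_derivative C (at y) h) $ s)) (at y)" if "y \<in> U" for y s
    by (intro bounded_linear.has_derivative[OF bounded_linear_vec_nth]
        bounded_linear.has_derivative[OF bounded_linear_lengths] conformal_structure_has_derivative[OF C that])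
  have C_eqs: "partial a (\<lambda>g. lengths T (C g) $ {a, b}) y = C y $ (a, b)"
    "k \<noteq> a \<Longrightarrow> k \<noteq> b \<Longrightarrow> partial k (\<lambda>g. C g $ (a, b)) y = 0"
    if "(a, b) \<in> directed_edges T" "y \<in> U" for a b k y
  proof -
    have *: "\<forall>f\<in>U. \<forall>(i, j)\<in>directed_edges T.
        partial i (\<lambda>g. lengths T (C g) $ {i, j}) f = C f $ (i, j) \<and>
        (\<forall>k. k \<noteq> i \<and> k \<noteq> j \<longrightarrow> partial k (\<lambda>g. C g $ (i, j)) f = 0)"
      using C unfolding conformal_structure_def by (elim conjE)
    from bspec[OF bspec[OF * that(2)] that(1)]
    show "partial a (\<lambda>g. lengths T (C g) $ {a, b}) y = C y $ (a, b)"
      "k \<noteq> a \<Longrightarrow> k \<noteq> b \<Longrightarrow> partial k (\<lambda>g. C g $ (a, b)) y = 0" by simp_all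
  qed
  have ax: "lengths T (frechet_derivative C (at y) (axis a 1)) $ {a, b} = C y $ (a, b)"
    if "(a, b) \<in> directed_edges T" "y \<in> U" for a b y
    using C_eqs(1)[OF that] partial_eq[OF dl[OF that(2)], of a "{a, b}"] by simp
  have z: "C' (axis k 1) $ (a, b) = 0"
    if "(a, b) \<in> directed_edges T" "k \<noteq> a" "k \<noteq> b" for a b k
    using C_eqs(2)[OF that(1) g that(2,3)] partial_eq[OF dC[OF g], of k "(a, b)"]
    by (simp add: C'_def)
  have "C' (axis j 1) $ (i, j) = C' (axis i 1) $ (j, i)"
    unfolding C'_def
  proof (rule mixed_derivatives_eq[OF U g dl[of _ "{i, j}"], of "axis i 1" _ "axis j 1"])
    have tr: "((\<lambda>y. lengths T (frechet_derivative C (at y) (axis a 1)) $ {a, b}) has_derivative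
        (\<lambda>h. frechet_derivative C (at g) h $ (a, b))) (at g)" if "(a, b) \<in> directed_edges T" for a b
      by (rule has_derivative_transform_within_open[OF dC[OF g] U g]) (simp add: ax that)
    show "((\<lambda>y. lengths T (frechet_derivative C (at y) (axis i 1)) $ {i, j}) has_derivative
        (\<lambda>h. frechet_derivative C (at g) h $ (i, j))) (at g)" by (rule tr[OF e])
    show "((\<lambda>y. lengths T (frechet_derivative C (at y) (axis j 1)) $ {i, j}) has_derivative
        (\<lambda>h. frechet_derivative C (at g) h $ (j, i))) (at g)"
      using tr[OF e'] by (simp add: insert_commute)
  qed
  then have q: "C' (axis j 1) $ (i, j) = q" "C' (axis i 1) $ (j, i) = q"
    unfolding q_def partial_eq[OF dC[OF g]] C'_def by simp_all
  then show "q = partial i (\<lambda>g. C g $ (j, i)) g"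
    unfolding partial_eq[OF dC[OF g]] C'_def by simp
  have r: "C' (axis i 1) $ (i, j) = C g $ (i, j) - q" "C' (axis j 1) $ (j, i) = C g $ (j, i) - q"
    using ax[OF e g] ax[OF e' g] q unfolding lengths_edge[OF e] lengths_edge[OF e'] C'_def[symmetric] by simp_all
  have lin: "linear C'" unfolding C'_def by (rule has_derivative_linear[OF conformal_structure_has_derivative[OF C g]])
  have ex: "C' h $ (a, b) = h $ a * C' (axis a 1) $ (a, b) + h $ b * C' (axis b 1) $ (a, b)"
    if ab: "(a, b) \<in> directed_edges T" for a b
  proof -
    have "C' h = C' (\<Sum>k\<in>UNIV. h $ k *\<^sub>R axis k 1)"
      by (simp add: basis_expansion[of h, unfolded scalar_mult_eq_scaleR])
    then have "C' h $ (a, b) = (\<Sum>k\<in>UNIV. h $ k * C' (axis k 1) $ (a, b))"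
      by (simp add: linear_sum[OF lin] linear_scale[OF lin])
    also have "\<dots> = (\<Sum>k\<in>{a, b}. h $ k * C' (axis k 1) $ (a, b))"
      by (rule sum.mono_neutral_right) (use z[OF ab] in auto)
    finally show ?thesis using ab by (simp add: directed_edges_def)
  qed
  show 1: "C' h $ (i, j) = C g $ (i, j) * h $ i + q * (h $ j - h $ i)"
    unfolding ex[OF e] q r by (simp add: algebra_simps)
  show "lengths T (C' h) $ {i, j} = C g $ (i, j) * h $ i + C g $ (j, i) * h $ j"
    unfolding lengths_edge[OF e] ex[OF e] ex[OF e'] q r by (simp add: algebra_simps)
qed

lemma conformal_structure_piecewise_flat:
  assumes "conformal_structure T U C" "g \<in> U"
  shows "\<forall>\<^sub>F y in nhds g. piecewise_flat T (lengths T (C y))"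
proof -
  have "\<forall>\<^sub>F y in nhds g. y \<in> U"
    using assms by (auto simp: conformal_structure_def eventually_nhds)
  then show ?thesis
    by eventually_elim (use assms in \<open>auto simp: conformal_structure_def metrics_def\<close>)
qed

lemma sum_directed_edges:
  fixes T :: "'v::finite set set"
  shows "(\<Sum>(i, j)\<in>directed_edges T. F i j) = (\<Sum>i\<in>UNIV. \<Sum>j | (i, j) \<in> directed_edges T. F i j)"
proof -
  have "(SIGMA i:UNIV. {j. (i, j) \<in> directed_edges T}) = directed_edges T" by auto
  then show ?thesis by (simp add: sum.Sigma)
qed

lemma EHR_conformal_has_derivative:
  fixes T :: "'v::finite set set"
  assumes T: "simplicial_complex_on_UNIV T" and C: "conformal_structure T U C" and g: "g \<in> U"
  shows "((\<lambda>g. EHR T (lengths T (C g))) has_derivative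
    (\<lambda>h. \<Sum>i\<in>UNIV. scalar_curvature T (C g) i * h $ i)) (at g)"
proof (rule has_derivative_eq_rhs)
  let ?K = "angle_deficit T (lengths T (C g))" and ?d = "C g"
  show "((\<lambda>g. EHR T (lengths T (C g))) has_derivative (\<lambda>h. (\<Sum>(i, j)\<in>directed_edges T.
      ?K i j * lengths T (frechet_derivative C (at g) h) $ {i, j}) / 2)) (at g)"
    by (intro EHR_has_derivative[OF T] conformal_structure_piecewise_flat[OF C g]
        bounded_linear.has_derivative[OF bounded_linear_lengths] conformal_structure_has_derivative[OF C g])
  show "(\<lambda>h. (\<Sum>(i, j)\<in>directed_edges T.
      ?K i j * lengths T (frechet_derivative C (at g) h) $ {i, j}) / 2) =
    (\<lambda>h. \<Sum>i\<in>UNIV. scalar_curvature T (C g) i * h $ i)"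
  proof
    fix h
    have "(\<Sum>(i, j)\<in>directed_edges T. ?K i j * lengths T (frechet_derivative C (at g) h) $ {i, j}) =
      (\<Sum>(i, j)\<in>directed_edges T. ?K i j * ?d $ (i, j) * h $ i) +
      (\<Sum>(i, j)\<in>directed_edges T. ?K j i * ?d $ (j, i) * h $ j)"
      unfolding sum.distrib[symmetric] case_prod_unfold
      by (rule sum.cong) (auto simp: conformal_lengths_derivative[OF C g] 
          angle_deficit_commute[of T "lengths T (C g)"] algebra_simps)
    also have "\<dots> = 2 * (\<Sum>(i, j)\<in>directed_edges T. ?K i j * ?d $ (i, j) * h $ i)"
      using sum_directed_edges_swap[of "\<lambda>i j. ?K i j * ?d $ (i, j) * h $ i" T] by simp
    also have "\<dots> = 2 * (\<Sum>i\<in>UNIV. scalar_curvature T (C g) i * h $ i)"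
      by (simp add: sum_directed_edges scalar_curvature_def sum_distrib_right)
    finally show "(\<Sum>(i, j)\<in>directed_edges T. ?K i j * lengths T (frechet_derivative C (at g) h) $ {i, j}) / 2 =
      (\<Sum>i\<in>UNIV. scalar_curvature T (C g) i * h $ i)" by simp
  qed
qed


section \<open>The second variation\<close>

text \<open>Three sources contribute to the derivative of \<open>\<Sum>\<^sub>i K\<^sub>i v\<^sub>i\<close>: the deficits give the dual lengths,
  the \<open>d\<^sub>i\<^sub>j\<close> give \<open>K\<^sub>i v\<^sub>i\<^sup>2\<close> and the terms in \<open>q\<close>, and \<open>v\<close> gives the acceleration.\<close>

lemma EHR_conformal_second_derivative:
  fixes T :: "'v::finite set set"
  assumes T: "simplicial_complex_on_UNIV T" and C: "conformal_structure T U C" and U: "f 0 \<in> U"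
    and f: "(f has_vector_derivative v 0) (at 0)" and v: "(v has_vector_derivative a) (at 0)"
  defines "d \<equiv> C (f 0)"
  defines "len \<equiv> lengths T d"
  defines "q \<equiv> (\<lambda>i j. partial j (\<lambda>g. C g $ (i, j)) (f 0))"
  shows "((\<lambda>t. \<Sum>i\<in>UNIV. scalar_curvature T (C (f t)) i * v t $ i) has_real_derivative
    (\<Sum>i\<in>UNIV. \<Sum>j | (i, j) \<in> directed_edges T.
      (dual_length T d i j / len $ {i, j} - q i j / (2 * len $ {i, j}) * edge_curvature T len i j)
        * (v 0 $ j - v 0 $ i)\<^sup>2)
    + (\<Sum>i\<in>UNIV. scalar_curvature T d i * ((v 0 $ i)\<^sup>2 + a $ i))) (at 0)"
proof -
  let ?E = "directed_edges T"
  let ?K = "angle_deficit T len"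
  define C' where "C' = frechet_derivative C (at (f 0))"
  have fd: "(f has_derivative (\<lambda>h. h *\<^sub>R v 0)) (at 0)" using f by (simp add: has_vector_derivative_def)
  have Cd: "((\<lambda>t. C (f t)) has_derivative (\<lambda>h. C' (h *\<^sub>R v 0))) (at 0)"
    unfolding C'_def by (rule has_derivative_compose[OF fd conformal_structure_has_derivative[OF C U]])
  have ld: "((\<lambda>t. lengths T (C (f t))) has_derivative (\<lambda>h. lengths T (C' (h *\<^sub>R v 0)))) (at 0)"
    by (rule bounded_linear.has_derivative[OF bounded_linear_lengths Cd])
  have "(f \<longlongrightarrow> f 0) (nhds 0)"
    using has_derivative_continuous[OF fd] by (simp add: isCont_def tendsto_at_iff_tendsto_nhds)
  then have ev: "\<forall>\<^sub>F t in nhds 0. piecewise_flat T (lengths T (C (f t)))"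
    using conformal_structure_piecewise_flat[OF C U] by (rule eventually_compose_filterlim[rotated])
  have dm: "d \<in> metrics T" using C U by (auto simp: conformal_structure_def d_def)
  obtain D where D: "\<And>i j. ((\<lambda>t. angle_deficit T (lengths T (C (f t))) i j) has_derivative D i j) (at 0)"
    and Dsum: "\<And>h. (\<Sum>(i, j)\<in>?E. D i j h * d $ (i, j) * (h * v 0 $ i)) =
      (\<Sum>(i, j)\<in>?E. dual_length T d i j / len $ {i, j} * (h * v 0 $ j - h * v 0 $ i)\<^sup>2)"
    by (rule conformal_angle_deficit_variation[OF T ld ev dm, where \<phi> = "\<lambda>h i. h * v 0 $ i"])
      (auto simp: d_def len_def C'_def conformal_lengths_derivative[OF C U])
  have D1: "((\<lambda>t. angle_deficit T (lengths T (C (f t))) i j) has_real_derivative D i j 1) (at 0)" for i j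
  proof (rule has_derivative_imp_has_field_derivative[OF D])
    show "x * D i j 1 = D i j x" for x
      using linear_scale[OF has_derivative_linear[OF D[of i j]], of x 1] by simp
  qed
  have c1: "((\<lambda>t. C (f t) $ (i, j)) has_real_derivative
      d $ (i, j) * v 0 $ i + q i j * (v 0 $ j - v 0 $ i)) (at 0)" if "(i, j) \<in> ?E" for i j
    by (rule has_derivative_imp_has_field_derivative[OF bounded_linear.has_derivative[OF bounded_linear_vec_nth Cd]])
      (simp add: C'_def conformal_metric_derivative[OF C U that] d_def q_def algebra_simps)
  have v1: "((\<lambda>t. v t $ i) has_real_derivative a $ i) (at 0)" for i
    using bounded_linear.has_vector_derivative[OF bounded_linear_vec_nth v]
    by (simp add: has_real_derivative_iff_has_vector_derivative)
  have len_pos: "len $ {i, j} \<noteq> 0" if "(i, j) \<in> ?E" for i j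
  proof -
    have "{i, j} \<in> T" "i \<noteq> j" using that by (auto simp: directed_edges_def)
    moreover from this obtain p where "realizes p {i, j} len"
      using dm unfolding metrics_def piecewise_flat_def len_def by blast
    ultimately show ?thesis using realizes_dist(2)[of p "{i, j}" len i j] by auto
  qed
  \<comment> \<open>Exchanging \<open>i\<close> and \<open>j\<close> and averaging turns \<open>(v\<^sub>j - v\<^sub>i) v\<^sub>i\<close> into \<open>- (v\<^sub>j - v\<^sub>i)\<^sup>2 / 2\<close>.\<close>
  define S where "S = (\<Sum>(i, j)\<in>?E. ?K i j * q i j * (v 0 $ j - v 0 $ i) * v 0 $ i)"
  have "2 * S = (\<Sum>(i, j)\<in>?E. ?K i j * q i j * (v 0 $ j - v 0 $ i) * v 0 $ i) +
      (\<Sum>(i, j)\<in>?E. ?K j i * q j i * (v 0 $ i - v 0 $ j) * v 0 $ j)"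
    unfolding S_def
    using sum_directed_edges_swap[of "\<lambda>i j. ?K i j * q i j * (v 0 $ j - v 0 $ i) * v 0 $ i" T] by simp
  also have "\<dots> = (\<Sum>(i, j)\<in>?E. - (?K i j * q i j * (v 0 $ j - v 0 $ i)\<^sup>2))"
    unfolding sum.distrib[symmetric] case_prod_unfold
  proof (rule sum.cong[OF refl])
    fix e assume "e \<in> ?E"
    then have *: "q (snd e) (fst e) = q (fst e) (snd e)" "?K (snd e) (fst e) = ?K (fst e) (snd e)"
      using conformal_q_commute[OF C U, of "fst e" "snd e"] angle_deficit_commute
      by (auto simp: q_def)
    show "?K (fst e) (snd e) * q (fst e) (snd e) * (v 0 $ snd e - v 0 $ fst e) * v 0 $ fst e +
      ?K (snd e) (fst e) * q (snd e) (fst e) * (v 0 $ fst e - v 0 $ snd e) * v 0 $ snd e =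
      - (?K (fst e) (snd e) * q (fst e) (snd e) * (v 0 $ snd e - v 0 $ fst e)\<^sup>2)"
      unfolding * by (simp add: power2_eq_square algebra_simps)
  qed
  also have "\<dots> = 2 * (- (\<Sum>(i, j)\<in>?E. q i j / (2 * len $ {i, j}) * edge_curvature T len i j * (v 0 $ j - v 0 $ i)\<^sup>2))"
    unfolding case_prod_unfold sum_negf[symmetric] sum_distrib_left
    by (rule sum.cong) (auto simp: edge_curvature_def len_pos)
  finally have S: "S = - (\<Sum>(i, j)\<in>?E. q i j / (2 * len $ {i, j}) * edge_curvature T len i j * (v 0 $ j - v 0 $ i)\<^sup>2)"
    by simp
  have "((\<lambda>t. \<Sum>(i, j)\<in>?E. angle_deficit T (lengths T (C (f t))) i j * C (f t) $ (i, j) * v t $ i) has_real_derivative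
    (\<Sum>(i, j)\<in>?E. (D i j 1 * d $ (i, j) + (d $ (i, j) * v 0 $ i + q i j * (v 0 $ j - v 0 $ i)) * ?K i j) * v 0 $ i
      + a $ i * (?K i j * d $ (i, j)))) (at 0)"
    unfolding case_prod_unfold
  proof (rule DERIV_sum)
    fix e assume "e \<in> ?E"
    then have "(fst e, snd e) \<in> ?E" by simp
    from DERIV_mult[OF DERIV_mult[OF D1 c1[OF this]] v1[of "fst e"]]
    show "((\<lambda>t. angle_deficit T (lengths T (C (f t))) (fst e) (snd e) * C (f t) $ (fst e, snd e) * v t $ fst e)
      has_real_derivative (D (fst e) (snd e) 1 * d $ (fst e, snd e) +
        (d $ (fst e, snd e) * v 0 $ fst e + q (fst e) (snd e) * (v 0 $ snd e - v 0 $ fst e)) * ?K (fst e) (snd e)) * v 0 $ fst e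
      + a $ fst e * (?K (fst e) (snd e) * d $ (fst e, snd e))) (at 0)"
      by (simp only: d_def len_def)
  qed
  also have "(\<lambda>t. \<Sum>(i, j)\<in>?E. angle_deficit T (lengths T (C (f t))) i j * C (f t) $ (i, j) * v t $ i) =
      (\<lambda>t. \<Sum>i\<in>UNIV. scalar_curvature T (C (f t)) i * v t $ i)"
    by (simp add: sum_directed_edges scalar_curvature_def sum_distrib_right)
  also have "(\<Sum>(i, j)\<in>?E. (D i j 1 * d $ (i, j) + (d $ (i, j) * v 0 $ i + q i j * (v 0 $ j - v 0 $ i)) * ?K i j) * v 0 $ i
      + a $ i * (?K i j * d $ (i, j))) =
    (\<Sum>(i, j)\<in>?E. D i j 1 * d $ (i, j) * (1 * v 0 $ i)) + S
    + (\<Sum>(i, j)\<in>?E. ?K i j * d $ (i, j) * ((v 0 $ i)\<^sup>2 + a $ i))"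
    unfolding S_def sum.distrib[symmetric] case_prod_unfold
    by (rule sum.cong) (auto simp: power2_eq_square algebra_simps)
  also have "\<dots> = (\<Sum>i\<in>UNIV. \<Sum>j | (i, j) \<in> ?E.
      (dual_length T d i j / len $ {i, j} - q i j / (2 * len $ {i, j}) * edge_curvature T len i j)
        * (v 0 $ j - v 0 $ i)\<^sup>2)
    + (\<Sum>i\<in>UNIV. scalar_curvature T d i * ((v 0 $ i)\<^sup>2 + a $ i))"
    unfolding Dsum S unfolding sum_directed_edges
    by (simp add: scalar_curvature_def len_def sum_distrib_right sum_subtractf left_diff_distrib)
  finally show ?thesis .
qed

theorem theorem24:
  fixes M :: "'m topology" and T :: "'v::finite set set"
    and dbar :: "real ^ ('v \<times> 'v)"
    and f :: "real \<Rightarrow> real ^ 'v" and \<epsilon> :: real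
    and U :: "(real ^ 'v) set" and C :: "real ^ 'v \<Rightarrow> real ^ ('v \<times> 'v)"
  assumes "closed_triangulated_manifold 3 M T"
    and "dbar \<in> metrics T"
    and "conformal_variation T dbar \<epsilon> f"
    and "conformal_extension T dbar \<epsilon> f U C"
  shows "let len = lengths T dbar;
             E = (\<lambda>t. EHR T (lengths T (C (f t))));
             f' = (\<lambda>i. deriv (\<lambda>t. f t $ i) 0);
             f'' = (\<lambda>i. deriv (deriv (\<lambda>t. f t $ i)) 0);
             K = scalar_curvature T dbar;
             Ke = edge_curvature T len;
             ldual = dual_length T dbar;
             q = (\<lambda>i j. partial j (\<lambda>g. C g $ (i, j)) (f 0));
             Q = (\<Sum>i\<in>UNIV. \<Sum>j | (i, j) \<in> directed_edges T.
                    (ldual i j / len $ {i, j} - q i j / (2 * len $ {i, j}) * Ke i j) * (f' j - f' i)\<^sup>2)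
         in
           (\<forall>(i, j)\<in>directed_edges T. q i j = partial i (\<lambda>g. C g $ (j, i)) (f 0)) \<and>
           (E has_real_derivative (\<Sum>i\<in>UNIV. K i * f' i)) (at 0) \<and>
           has_second_real_derivative E (Q + (\<Sum>i\<in>UNIV. K i * ((f' i)\<^sup>2 + f'' i))) 0 \<and>
           (critical_point_on (\<lambda>g. EHR T (lengths T (C g))) U (f 0) \<longleftrightarrow> (\<forall>i. K i = 0)) \<and>
           (critical_point_on (\<lambda>g. EHR T (lengths T (C g))) U (f 0) \<longrightarrow>
              has_second_real_derivative E Q 0) \<and>
           (critical_point_on (EHR T) {l. piecewise_flat T l} len \<longrightarrow>
              (\<forall>(i, j)\<in>directed_edges T. Ke i j = 0) \<and>
              has_second_real_derivative E
                (\<Sum>i\<in>UNIV. \<Sum>j | (i, j) \<in> directed_edges T.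
                   ldual i j / len $ {i, j} * (f' j - f' i)\<^sup>2) 0)"
proof -
  have T: "simplicial_complex_on_UNIV T" using assms(1) by (simp add: closed_triangulated_manifold_def)
  have C: "conformal_structure T U C" and fU: "f ` {-\<epsilon><..<\<epsilon>} \<subseteq> U" and d: "C (f 0) = dbar"
    using assms(4) by (auto simp: conformal_extension_def)
  have "0 < \<epsilon>" "smooth_on {-\<epsilon><..<\<epsilon>} f" using assms(3) by (auto simp: conformal_variation_def)
  define I where "I = {-\<epsilon><..<\<epsilon>}"
  have I: "open I" "0 \<in> I" using \<open>0 < \<epsilon>\<close> by (auto simp: I_def)
  have U: "f t \<in> U" if "t \<in> I" for t using fU that by (auto simp: I_def)
  have "open U" using C by (simp add: conformal_structure_def)
  define v where "v = (\<lambda>t. frechet_derivative f (at t) 1)"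
  have "Ck_on (Suc (Suc 0)) I f" using \<open>smooth_on _ f\<close> unfolding smooth_on_def I_def by blast
  then have diff: "f differentiable (at t)" "v differentiable (at t)" if "t \<in> I" for t
    using that by (simp_all add: v_def)
  have f: "(f has_vector_derivative v t) (at t)" if "t \<in> I" for t
  proof -
    have *: "(f has_derivative frechet_derivative f (at t)) (at t)"
      using diff(1)[OF that] by (simp add: frechet_derivative_works)
    moreover have "frechet_derivative f (at t) = (\<lambda>h. h *\<^sub>R v t)"
    proof
      show "frechet_derivative f (at t) h = h *\<^sub>R v t" for h
        using linear_scale[OF has_derivative_linear[OF *], of h 1] by (simp add: v_def)
    qed
    ultimately show ?thesis unfolding has_vector_derivative_def by simp
  qed
  obtain a where a: "(v has_vector_derivative a) (at 0)"
    using diff(2)[OF I(2)] vector_derivative_works by blast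
  have fi: "((\<lambda>t. f t $ i) has_real_derivative v t $ i) (at t)" if "t \<in> I" for t i
    using bounded_linear.has_vector_derivative[OF bounded_linear_vec_nth f[OF that]]
    by (simp add: has_real_derivative_iff_has_vector_derivative)
  have f': "deriv (\<lambda>t. f t $ i) t = v t $ i" if "t \<in> I" for t i
    by (rule DERIV_imp_deriv[OF fi[OF that]])
  have f'': "deriv (deriv (\<lambda>t. f t $ i)) 0 = a $ i" for i
  proof -
    have "((\<lambda>t. v t $ i) has_real_derivative a $ i) (at 0)"
      using bounded_linear.has_vector_derivative[OF bounded_linear_vec_nth a]
      by (simp add: has_real_derivative_iff_has_vector_derivative)
    then have "(deriv (\<lambda>t. f t $ i) has_real_derivative a $ i) (at 0)"
      by (rule has_field_derivative_transform_within_open[OF _ I]) (simp add: f')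
    then show ?thesis by (rule DERIV_imp_deriv)
  qed
  define E where "E = (\<lambda>t. EHR T (lengths T (C (f t))))"
  define len where "len = lengths T dbar"
  define K where "K = scalar_curvature T dbar"
  define q where "q = (\<lambda>i j. partial j (\<lambda>g. C g $ (i, j)) (f 0))"
  define Q where "Q = (\<Sum>i\<in>UNIV. \<Sum>j | (i, j) \<in> directed_edges T.
      (dual_length T dbar i j / len $ {i, j} - q i j / (2 * len $ {i, j}) * edge_curvature T len i j)
        * (v 0 $ j - v 0 $ i)\<^sup>2)"
  have E1: "(E has_real_derivative (\<Sum>i\<in>UNIV. scalar_curvature T (C (f t)) i * v t $ i)) (at t)"
    if "t \<in> I" for t
    unfolding E_def has_field_derivative_def
    by (rule has_derivative_eq_rhs[OF has_derivative_compose[OF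
            f[OF that, unfolded has_vector_derivative_def] EHR_conformal_has_derivative[OF T C U[OF that]]]])
      (auto simp: fun_eq_iff sum_distrib_left sum_distrib_right mult_ac)
  have E2: "has_second_real_derivative E (Q + (\<Sum>i\<in>UNIV. K i * ((v 0 $ i)\<^sup>2 + a $ i))) 0"
    unfolding has_second_real_derivative_def
  proof (intro exI conjI)
    show "\<forall>\<^sub>F t in nhds 0. (E has_real_derivative (\<Sum>i\<in>UNIV. scalar_curvature T (C (f t)) i * v t $ i)) (at t)"
      using I E1 by (auto simp: eventually_nhds)
    show "((\<lambda>t. \<Sum>i\<in>UNIV. scalar_curvature T (C (f t)) i * v t $ i) has_real_derivative
        (Q + (\<Sum>i\<in>UNIV. K i * ((v 0 $ i)\<^sup>2 + a $ i)))) (at 0)"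
      using EHR_conformal_second_derivative[OF T C U[OF I(2)] f[OF I(2)] a]
      unfolding Q_def K_def q_def len_def d .
  qed
  have crit: "critical_point_on (\<lambda>g. EHR T (lengths T (C g))) U (f 0) \<longleftrightarrow> (\<forall>i. K i = 0)"
  proof -
    note der = EHR_conformal_has_derivative[OF T C U[OF I(2)], unfolded d]
    have at: "at (f 0) within U = at (f 0)" by (rule at_within_open[OF U[OF I(2)] \<open>open U\<close>])
    show ?thesis
    proof
      assume "critical_point_on (\<lambda>g. EHR T (lengths T (C g))) U (f 0)"
      then have "((\<lambda>g. EHR T (lengths T (C g))) has_derivative (\<lambda>_. 0)) (at (f 0))"
        by (simp add: critical_point_on_def at)
      from has_derivative_unique[OF der this]
      have 0: "(\<Sum>i\<in>UNIV. scalar_curvature T dbar i * h $ i) = 0" for h by metis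
      show "\<forall>i. K i = 0"
      proof
        fix i
        have "(\<Sum>j\<in>UNIV. scalar_curvature T dbar j * axis i 1 $ j) = scalar_curvature T dbar i"
          by (simp add: axis_def if_distrib[of "\<lambda>x. _ * x"] cong: if_cong)
        then show "K i = 0" using 0[of "axis i 1"] by (simp add: K_def)
      qed
    next
      assume "\<forall>i. K i = 0"
      then show "critical_point_on (\<lambda>g. EHR T (lengths T (C g))) U (f 0)"
        using der U[OF I(2)] by (simp add: critical_point_on_def at K_def)
    qed
  qed
  have E2_crit: "has_second_real_derivative E Q 0" if "\<forall>i. K i = 0"
    using E2 that by simp
  have q: "\<forall>(i, j)\<in>directed_edges T. q i j = partial i (\<lambda>g. C g $ (j, i)) (f 0)"
    using conformal_q_commute[OF C U[OF I(2)]] by (auto simp: q_def)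
  have flat: "(\<forall>(i, j)\<in>directed_edges T. edge_curvature T len i j = 0) \<and>
      has_second_real_derivative E (\<Sum>i\<in>UNIV. \<Sum>j | (i, j) \<in> directed_edges T.
        dual_length T dbar i j / len $ {i, j} * (v 0 $ j - v 0 $ i)\<^sup>2) 0"
    if "critical_point_on (EHR T) {l. piecewise_flat T l} len"
  proof -
    have 0: "angle_deficit T len i j = 0" if "(i, j) \<in> directed_edges T" for i j
      using critical_lengths_imp_flat[OF T \<open>critical_point_on _ _ _\<close> that] .
    then have Ke: "edge_curvature T len i j = 0" if "(i, j) \<in> directed_edges T" for i j
      using that by (simp add: edge_curvature_def)
    have "\<forall>i. K i = 0" using 0 by (simp add: K_def scalar_curvature_def len_def)
    then have "has_second_real_derivative E Q 0" by (rule E2_crit)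
    moreover have "Q = (\<Sum>i\<in>UNIV. \<Sum>j | (i, j) \<in> directed_edges T.
        dual_length T dbar i j / len $ {i, j} * (v 0 $ j - v 0 $ i)\<^sup>2)"
      unfolding Q_def by (intro sum.cong refl) (simp add: Ke)
    ultimately show ?thesis using Ke by auto
  qed
  show ?thesis
    unfolding Let_def f'[OF I(2)] f''
    unfolding E_def[symmetric] len_def[symmetric] K_def[symmetric]
    using q E1[OF I(2)] E2 crit E2_crit flat
    unfolding q_def Q_def K_def d by blast
qed

end
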